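(* Let $M$ be a catenoid representation of the equioriented quiver $\Gamma$ of type $A_n$ and $\mathbf{e}$ a dimension vector, and identify $\mathrm{Gr}_{\mathbf{e}}(M)$ with its image $\mathrm{Gr}_{\mathbf{f}}(Q\to R)\subseteq\mathcal{F}l_{\mathbf{f}}(R_n)$. Then the $T_N$-fixed points of $\mathrm{Gr}_{\mathbf{e}}(M)$ are labelled by the elements of $W^0(M,\mathbf{e})$ (via $w\mapsto p(w)$); $\mathrm{Gr}_{\mathbf{e}}(M)$ admits a cellular decomposition whose cells are the $B_N$-orbits of the $T_N$-fixed points; and the irreducible components of $\mathrm{Gr}_{\mathbf{e}}(M)$ are parametrized by the elements of $S(M,\mathbf{e})$.
   Context: $\Gamma$ is the quiver $1\to\cdots\to n$; representations are finite-dimensional over $\mathbb{C}$; $M$ is catenoid if its pairwise non-isomorphic indecomposable summands are totally ordered by $M[i,j]\le M[k,\ell]\iff i\le k,\ j\le\ell$ ($M[i,j]$ the indecomposable supported on $[i,j]$). $\mathrm{Gr}_{\mathbf{e}}(M)$ is the quiver Grassmannian of subrepresentations of dimension vector $\mathbf{e}$. Let $0\to Q\xrightarrow{\iota}R\xrightarrow{\pi}M\to0$ be a minimal projective resolution; $R$ is a chain $R_1\subseteq\cdots\subseteq R_n$ and $\iota(Q)$ a chain $Q_1\subseteq\cdots\subseteq Q_n$, $Q_a\subseteq R_a$; $r_a=\dim R_a$, $q_a=\dim Q_a$, $N=r_n$, $\mathbf{f}=\mathbf{e}+\mathbf{dim}\,Q$. $\mathrm{Gr}_{\mathbf{f}}(Q\to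 R)$ is the set of flags $\mathcal{U}_1\subseteq\cdots\subseteq\mathcal{U}_n\subseteq R_n$ with $\dim\mathcal{U}_a=f_a$ and $Q_a\subseteq\mathcal{U}_a\subseteq R_a$; $N'\mapsto\pi^{-1}(N')$ identifies it with $\mathrm{Gr}_{\mathbf{e}}(M)$. For catenoid $M$ fix a basis $v_1,\dots,v_N$ of $R_n$ with $R_a=\mathrm{span}(v_1,\dots,v_{r_a})$, $Q_a=\mathrm{span}(v_1,\dots,v_{q_a})$; $B_N$ (resp. $T_N$) are the upper triangular (resp. diagonal) invertible matrices in this basis. For $w\in\mathcal{S}_N$, $p(w)$ is the flag with $a$-th space $\mathrm{span}(v_{w(1)},\dots,v_{w(f_a)})$. $w$ is $(M,\mathbf{e})$-compatible if $\{1,\dots,q_a\}\subseteq w(\{1,\dots,f_a\})\subseteq\{1,\dots,r_a\}$ for all $a$; two compatible elements are equivalent if they have the same sets $w(\{1,\dots,f_a\})$ for all $a$; $W^0(M,\mathbf{e})$ contains one minimal-length element of each class. Writing $w(\{1,\dots,f_a\})=\{k^a_1(w)<\cdots<k^a_{f_a}(w)\}$, $w_1\le w_2$ iff $k^a_i(w_1)\le k^a_i(w_2)$ for all $a,i$; $S(M,\mathbf{e})$ is the set of maximal elements of $W^0(M,\mathbf{e})$.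
   Formalization: The formal theorem assumes that f = e + dim Q is nondecreasing, so that p(w) is a flag; otherwise the claim can fail: for n=2, M=M[1,2], e=(1,0), W^0 = {id} while Gr_e(M) is empty. *)

theory Defs
  imports "HOL-Analysis.Abstract_Topology" "HOL-Library.Function_Algebras"
          "HOL-Combinatorics.Permutations"
begin

type_synonym vect = "nat \<Rightarrow> complex"
type_synonym matr = "nat \<times> nat \<Rightarrow> complex"
type_synonym flag = "nat \<Rightarrow> vect set"

definition sc :: "complex \<Rightarrow> vect \<Rightarrow> vect" where
  "sc c x = (\<lambda>i. c * x i)"

abbreviation vspan :: "vect set \<Rightarrow> vect set" where "vspan \<equiv> module.span sc"
abbreviation vdim :: "vect set \<Rightarrow> nat" where "vdim \<equiv> vector_space.dim sc"
abbreviation vsubspace :: "vect set \<Rightarrow> bool" where "vsubspace \<equiv> module.subspace sc"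

definition bvec :: "nat \<Rightarrow> vect" where
  "bvec k = (\<lambda>i. if i = k then 1 else 0)"

definition std_span :: "nat \<Rightarrow> vect set" where
  "std_span k = vspan (bvec ` {1..k})"

definition mat_supp :: "nat \<Rightarrow> matr \<Rightarrow> bool" where
  "mat_supp N g \<longleftrightarrow> (\<forall>i j. g (i,j) \<noteq> 0 \<longrightarrow> i \<in> {1..N} \<and> j \<in> {1..N})"

definition mmul :: "nat \<Rightarrow> matr \<Rightarrow> matr \<Rightarrow> matr" where
  "mmul N g h = (\<lambda>(i,j). \<Sum>k\<in>{1..N}. g (i,k) * h (k,j))"

definition idm :: "nat \<Rightarrow> matr" where
  "idm N = (\<lambda>(i,j). if i = j \<and> i \<in> {1..N} then 1 else 0)"

definition GL :: "nat \<Rightarrow> matr set" where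
  "GL N = {g. mat_supp N g \<and> (\<exists>h. mat_supp N h \<and> mmul N g h = idm N \<and> mmul N h g = idm N)}"

definition Borel :: "nat \<Rightarrow> matr set" where
  "Borel N = {g \<in> GL N. \<forall>i j. j < i \<longrightarrow> g (i,j) = 0}"

definition Torus :: "nat \<Rightarrow> matr set" where
  "Torus N = {g \<in> GL N. \<forall>i j. i \<noteq> j \<longrightarrow> g (i,j) = 0}"

definition mvec :: "nat \<Rightarrow> matr \<Rightarrow> vect \<Rightarrow> vect" where
  "mvec N g x = (\<lambda>i. \<Sum>j\<in>{1..N}. g (i,j) * x j)"

definition act :: "nat \<Rightarrow> matr \<Rightarrow> flag \<Rightarrow> flag" where
  "act N g U = (\<lambda>a. mvec N g ` U a)"

definition Fl :: "nat \<Rightarrow> nat \<Rightarrow> (nat \<Rightarrow> nat) \<Rightarrow> flag set" where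
  "Fl N n f = {U. (\<forall>a\<in>{1..n}. vsubspace (U a) \<and> U a \<subseteq> std_span N \<and> vdim (U a) = f a)
                 \<and> (\<forall>a\<in>{1..<n}. U a \<subseteq> U (Suc a))
                 \<and> (\<forall>a. a \<notin> {1..n} \<longrightarrow> U a = {0})}"

definition GrQR :: "nat \<Rightarrow> nat \<Rightarrow> (nat \<Rightarrow> nat) \<Rightarrow> (nat \<Rightarrow> nat) \<Rightarrow> (nat \<Rightarrow> nat) \<Rightarrow> flag set" where
  "GrQR N n f r q = {U \<in> Fl N n f. \<forall>a\<in>{1..n}. std_span (q a) \<subseteq> U a \<and> U a \<subseteq> std_span (r a)}"

definition frame :: "nat \<Rightarrow> nat \<Rightarrow> (nat \<Rightarrow> nat) \<Rightarrow> matr \<Rightarrow> flag" where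
  "frame N n f g = (\<lambda>a. if a \<in> {1..n} then vspan ((\<lambda>k i. g (i,k)) ` {1..f a}) else {0})"

definition pfl :: "nat \<Rightarrow> (nat \<Rightarrow> nat) \<Rightarrow> (nat \<Rightarrow> nat) \<Rightarrow> flag" where
  "pfl n f w = (\<lambda>a. if a \<in> {1..n} then vspan (bvec ` w ` {1..f a}) else {0})"

definition Borbit :: "nat \<Rightarrow> nat \<Rightarrow> (nat \<Rightarrow> nat) \<Rightarrow> (nat \<Rightarrow> nat) \<Rightarrow> flag set" where
  "Borbit N n f w = {act N b (pfl n f w) | b. b \<in> Borel N}"

definition torus_fixed :: "nat \<Rightarrow> flag set \<Rightarrow> flag set" where
  "torus_fixed N X = {U \<in> X. \<forall>t\<in>Torus N. act N t U = U}"

inductive polyfn :: "(('i \<Rightarrow> complex) \<Rightarrow> complex) \<Rightarrow> bool" where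
  pconst: "polyfn (\<lambda>x. c)"
| pvar: "polyfn (\<lambda>x. x i)"
| padd: "polyfn p \<Longrightarrow> polyfn q \<Longrightarrow> polyfn (\<lambda>x. p x + q x)"
| pmult: "polyfn p \<Longrightarrow> polyfn q \<Longrightarrow> polyfn (\<lambda>x. p x * q x)"

definition zar :: "('i \<Rightarrow> complex) set \<Rightarrow> ('i \<Rightarrow> complex) topology" where
  "zar A = topology (\<lambda>U. \<exists>P. (\<forall>p\<in>P. polyfn p) \<and> U = A - {x. \<forall>p\<in>P. p x = 0})"

text \<open>Zariski topology on Fl_f: quotient topology of the Zariski topology of GL_N
  under the projection GL_N -> GL_N/P = Fl_f.\<close>
definition fl_top :: "nat \<Rightarrow> nat \<Rightarrow> (nat \<Rightarrow> nat) \<Rightarrow> flag topology" where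
  "fl_top N n f = topology (\<lambda>U. U \<subseteq> Fl N n f \<and>
       openin (zar (GL N)) (GL N \<inter> frame N n f -` U))"

definition irreducible_in :: "'a topology \<Rightarrow> 'a set \<Rightarrow> bool" where
  "irreducible_in X S \<longleftrightarrow> S \<subseteq> topspace X \<and> S \<noteq> {} \<and>
     (\<forall>C1 C2. closedin X C1 \<and> closedin X C2 \<and> S \<subseteq> C1 \<union> C2 \<longrightarrow> S \<subseteq> C1 \<or> S \<subseteq> C2)"

definition irreducible_components :: "'a topology \<Rightarrow> 'a set set" where
  "irreducible_components X =
     {S. irreducible_in X S \<and> (\<forall>T. irreducible_in X T \<and> S \<subseteq> T \<longrightarrow> T = S)}"

definition regular_on :: "('i \<Rightarrow> complex) set \<Rightarrow> (('i \<Rightarrow> complex) \<Rightarrow> complex) \<Rightarrow> bool" where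
  "regular_on Y h \<longleftrightarrow> (\<forall>y\<in>Y. \<exists>U p q. openin (zar UNIV) U \<and> y \<in> U \<and> polyfn p \<and> polyfn q \<and>
       (\<forall>z\<in>Y \<inter> U. q z \<noteq> 0 \<and> h z = p z / q z))"

definition aff :: "nat \<Rightarrow> (nat \<Rightarrow> complex) set" where
  "aff d = {x. \<forall>i. x i \<noteq> 0 \<longrightarrow> i \<in> {1..d}}"

definition fl_morphism :: "nat \<Rightarrow> nat \<Rightarrow> (nat \<Rightarrow> nat) \<Rightarrow> (nat \<Rightarrow> complex) set \<Rightarrow> ((nat \<Rightarrow> complex) \<Rightarrow> flag) \<Rightarrow> bool" where
  "fl_morphism N n f Y \<psi> \<longleftrightarrow> (\<forall>y\<in>Y. \<exists>U g. openin (zar UNIV) U \<and> y \<in> U \<and>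
       (\<forall>ij. regular_on (Y \<inter> U) (\<lambda>z. g z ij)) \<and>
       (\<forall>z\<in>Y \<inter> U. g z \<in> GL N \<and> frame N n f (g z) = \<psi> z))"

text \<open>A subset C of Fl_f is an affine cell if it is isomorphic (as a variety) to some C^d:
  a bijective morphism C^d -> C whose inverse is a morphism C -> C^d (regularity of a map
  out of C is tested on its preimage in GL_N, the projection being a locally trivial
  P-bundle).\<close>
definition affine_cell :: "nat \<Rightarrow> nat \<Rightarrow> (nat \<Rightarrow> nat) \<Rightarrow> flag set \<Rightarrow> bool" where
  "affine_cell N n f C \<longleftrightarrow> (\<exists>d \<psi>. bij_betw \<psi> (aff d) C \<and> fl_morphism N n f (aff d) \<psi> \<and>
       (\<forall>k. regular_on (GL N \<inter> frame N n f -` C)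
                (\<lambda>g. inv_into (aff d) \<psi> (frame N n f g) k)))"

text \<open>A representation of 1 -> ... -> n given up to isomorphism by the multiplicities
  m i j of the interval modules M[i,j] (1 <= i <= j <= n).\<close>
definition interval_mult :: "nat \<Rightarrow> (nat \<Rightarrow> nat \<Rightarrow> nat) \<Rightarrow> bool" where
  "interval_mult n m \<longleftrightarrow> (\<forall>i j. m i j \<noteq> 0 \<longrightarrow> 1 \<le> i \<and> i \<le> j \<and> j \<le> n)"

definition catenoid :: "(nat \<Rightarrow> nat \<Rightarrow> nat) \<Rightarrow> bool" where
  "catenoid m \<longleftrightarrow> (\<forall>i j k l. m i j \<noteq> 0 \<longrightarrow> m k l \<noteq> 0 \<longrightarrow>
                      (i \<le> k \<and> j \<le> l) \<or> (k \<le> i \<and> l \<le> j))"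

text \<open>Minimal projective resolution: R = (+) P_i^{m i j}, Q = (+)_{j<n} P_{j+1}^{m i j},
  with P_i = M[i,n].  r_a = dim R_a, q_a = dim Q_a.\<close>
definition rdim :: "nat \<Rightarrow> (nat \<Rightarrow> nat \<Rightarrow> nat) \<Rightarrow> nat \<Rightarrow> nat" where
  "rdim n m a = (\<Sum>i\<in>{1..a}. \<Sum>j\<in>{i..n}. m i j)"

definition qdim :: "nat \<Rightarrow> (nat \<Rightarrow> nat \<Rightarrow> nat) \<Rightarrow> nat \<Rightarrow> nat" where
  "qdim n m a = (\<Sum>j\<in>{1..<a}. \<Sum>i\<in>{1..j}. m i j)"

definition compatible :: "nat \<Rightarrow> nat \<Rightarrow> (nat \<Rightarrow> nat) \<Rightarrow> (nat \<Rightarrow> nat) \<Rightarrow> (nat \<Rightarrow> nat) \<Rightarrow> (nat \<Rightarrow> nat) set" where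
  "compatible N n f r q = {w. w permutes {1..N} \<and>
     (\<forall>a\<in>{1..n}. {1..q a} \<subseteq> w ` {1..f a} \<and> w ` {1..f a} \<subseteq> {1..r a})}"

definition perm_equiv :: "nat \<Rightarrow> (nat \<Rightarrow> nat) \<Rightarrow> (nat \<Rightarrow> nat) \<Rightarrow> (nat \<Rightarrow> nat) \<Rightarrow> bool" where
  "perm_equiv n f w1 w2 \<longleftrightarrow> (\<forall>a\<in>{1..n}. w1 ` {1..f a} = w2 ` {1..f a})"

definition perm_length :: "nat \<Rightarrow> (nat \<Rightarrow> nat) \<Rightarrow> nat" where
  "perm_length N w = card {(i,j). i \<in> {1..N} \<and> j \<in> {1..N} \<and> i < j \<and> w j < w i}"

definition is_W0 :: "nat \<Rightarrow> nat \<Rightarrow> (nat \<Rightarrow> nat) \<Rightarrow> (nat \<Rightarrow> nat) \<Rightarrow> (nat \<Rightarrow> nat) \<Rightarrow> (nat \<Rightarrow> nat) set \<Rightarrow> bool" where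
  "is_W0 N n f r q W \<longleftrightarrow> W \<subseteq> compatible N n f r q \<and>
     (\<forall>w\<in>compatible N n f r q. \<exists>!w'\<in>W. perm_equiv n f w w') \<and>
     (\<forall>w\<in>W. \<forall>w'\<in>compatible N n f r q. perm_equiv n f w w' \<longrightarrow> perm_length N w \<le> perm_length N w')"

definition bruhat_le :: "nat \<Rightarrow> (nat \<Rightarrow> nat) \<Rightarrow> (nat \<Rightarrow> nat) \<Rightarrow> (nat \<Rightarrow> nat) \<Rightarrow> bool" where
  "bruhat_le n f w1 w2 \<longleftrightarrow> (\<forall>a\<in>{1..n}.
     list_all2 (\<le>) (sorted_list_of_set (w1 ` {1..f a})) (sorted_list_of_set (w2 ` {1..f a})))"

definition Smax :: "nat \<Rightarrow> (nat \<Rightarrow> nat) \<Rightarrow> (nat \<Rightarrow> nat) set \<Rightarrow> (nat \<Rightarrow> nat) set" where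
  "Smax n f W = {w \<in> W. \<forall>w'\<in>W. bruhat_le n f w w' \<longrightarrow> bruhat_le n f w' w}"

end

theory Submission
  imports Defs "Jordan_Normal_Form.Determinant"
begin

text \<open>For a subspace U of C^N let its leads be the positions of the last nonzero coordinates of its
  nonzero vectors. Upper triangular matrices preserve leads, and a nested pair of subspaces with
  equal leads is equal. So the Borel orbit of p(w) consists of all flags U in which the leads of the
  a-th space are w({1..f_a}), and membership in Gr(Q, R) is a condition on leads as well; hence
  Gr(Q, R) is a disjoint union of orbits. Reduced echelon form gives polynomial coordinates on an
  orbit, with inverse given by Cramer's rule. The tableau order is a condition on the vanishing of
  minors, so the union of all smaller orbits is closed; conversely, an exchange of two letters that
  increases the tableau realizes the smaller orbit as limits of curves in the larger one. Hence orbit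
  closures are ordered by the tableau order, and the components are the closures of the maximal
  orbits.\<close>

section \<open>Leads of subspaces\<close>

text \<open>The flag variety carries no coordinates of its own here: its topology is a quotient of
  that of \<open>GL N\<close>. Hence every geometric statement is made on frames g: closed sets are
  given by polynomials in the entries of g, limits by curves of frames, inverse charts by quotients
  of polynomials on frames. The letters of the overview come from the following encoding. The flag
  p(w) depends on w only through the increasing sets I_a = w({1..f_a}). Such a family is a word of
  length N: its letter at x is the first a with x in I_a, and n+1 if there is none. Classes of
  permutations are thus words of prescribed content, and the leads of any flag give such a word too.
  The entrywise comparison of tableaux becomes an inequality between the numbers of letters up to a
  among the first x positions, and these change in a controlled way under one exchange, so that
  comparable words are joined by a chain of exchanges. Closures are computed in the full flag
  variety, where the intermediate words of a chain need not be compatible with Q and R; as Gr(Q, R)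
  is a union of orbits, only the passage to the subspace topology remains.\<close>

interpretation V: vector_space sc
  by unfold_locales (auto simp: sc_def fun_eq_iff algebra_simps)

lemma sum_fun_app: "(\<Sum>l\<in>L. x l) i = (\<Sum>l\<in>L. x l i)"
  for x :: "'a \<Rightarrow> 'b \<Rightarrow> 'c::comm_monoid_add"
  by (induction L rule: infinite_finite_induct) auto

lemma sc_apply: "sc c x i = c * x i"
  by (simp add: sc_def)

lemma span_family:
  assumes "finite L"
  shows "vspan (x ` L) = range (\<lambda>c. \<Sum>l\<in>L. sc (c l) (x l))"
proof
  let ?R = "range (\<lambda>c. \<Sum>l\<in>L. sc (c l) (x l))"
  have "vsubspace ?R"
  proof (rule V.subspaceI)
    show "0 \<in> ?R"
      by (rule range_eqI[of _ _ "\<lambda>_. 0"]) simp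
  next
    fix u v assume "u \<in> ?R" "v \<in> ?R"
    then obtain c d where "u = (\<Sum>l\<in>L. sc (c l) (x l))" "v = (\<Sum>l\<in>L. sc (d l) (x l))" by auto
    then have "u + v = (\<Sum>l\<in>L. sc (c l + d l) (x l))"
      by (simp add: V.scale_left_distrib sum.distrib)
    then show "u + v \<in> ?R" by (intro range_eqI[of _ _ "\<lambda>l. c l + d l"])
  next
    fix a u assume "u \<in> ?R"
    then obtain c where "u = (\<Sum>l\<in>L. sc (c l) (x l))" by auto
    then have "sc a u = (\<Sum>l\<in>L. sc (a * c l) (x l))"
      by (simp add: V.scale_sum_right)
    then show "sc a u \<in> ?R" by (intro range_eqI[of _ _ "\<lambda>l. a * c l"])
  qed
  moreover have "x l \<in> ?R" if "l \<in> L" for l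
  proof (rule range_eqI[of _ _ "\<lambda>k. if k = l then 1 else 0"])
    have "(\<Sum>k\<in>L. sc (if k = l then 1 else 0) (x k)) = (\<Sum>k\<in>L. if k = l then x l else 0)"
      by (rule sum.cong) auto
    then show "x l = (\<Sum>k\<in>L. sc (if k = l then 1 else 0) (x k))"
      using assms that by simp
  qed
  ultimately show "vspan (x ` L) \<subseteq> ?R"
    by (intro V.span_minimal) auto
  show "?R \<subseteq> vspan (x ` L)"
    by (auto intro!: V.span_sum V.span_scale intro: V.span_base)
qed

text \<open>Injectivity of the indexing belongs to the conclusion because dimensions are later read
  off as cardinalities of index sets, not of sets of vectors.\<close>

lemma independent_family:
  assumes "finite L"
    and triv: "\<And>c. (\<Sum>l\<in>L. sc (c l) (x l)) = 0 \<Longrightarrow> \<forall>l\<in>L. c l = 0"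
  shows "inj_on x L" "V.independent (x ` L)"
proof -
  show inj: "inj_on x L"
  proof (rule inj_onI, rule ccontr)
    fix k l assume kl: "k \<in> L" "l \<in> L" "x k = x l" "k \<noteq> l"
    define c :: "'a \<Rightarrow> complex" where "c j = (if j = k then 1 else if j = l then - 1 else 0)" for j
    have "(\<Sum>j\<in>L. sc (c j) (x j)) = (\<Sum>j\<in>L. (if j = k then x k else 0) - (if j = l then x k else 0))"
      using kl by (intro sum.cong) (auto simp: c_def)
    also have "\<dots> = 0"
      using kl assms(1) by (simp add: sum_subtractf)
    finally have "c k = 0" using triv kl by blast
    then show False by (simp add: c_def)
  qed
  show "V.independent (x ` L)"
  proof
    assume "V.dependent (x ` L)"
    then obtain u where u: "\<exists>v\<in>x ` L. u v \<noteq> 0" "(\<Sum>v\<in>x ` L. sc (u v) v) = 0"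
      using V.dependent_finite[of "x ` L"] assms(1) by auto
    have "(\<Sum>l\<in>L. sc (u (x l)) (x l)) = 0"
      using u(2) inj by (simp add: sum.reindex)
    with triv[of "\<lambda>l. u (x l)"] u(1) show False by auto
  qed
qed

definition lead_at :: "vect \<Rightarrow> nat \<Rightarrow> bool" where
  "lead_at x k \<longleftrightarrow> x k \<noteq> 0 \<and> (\<forall>i>k. x i = 0)"

definition leads :: "vect set \<Rightarrow> nat set" where
  "leads U = {k. \<exists>x\<in>U. lead_at x k}"

definition coord :: "nat set \<Rightarrow> vect set" where
  "coord I = {x. \<forall>i. i \<notin> I \<longrightarrow> x i = 0}"

lemma lead_at_unique: "lead_at x k \<Longrightarrow> lead_at x l \<Longrightarrow> k = l"
  unfolding lead_at_def by (metis linorder_neqE_nat)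

lemma exists_lead:
  assumes "x \<noteq> 0" "x \<in> coord I" "finite I"
  obtains k where "lead_at x k" "k \<in> I"
proof -
  let ?S = "{i. x i \<noteq> 0}"
  have "?S \<subseteq> I" using assms by (auto simp: coord_def)
  then have fin: "finite ?S" using assms finite_subset by blast
  have ne: "?S \<noteq> {}" using assms by (auto simp: fun_eq_iff)
  have "lead_at x (Max ?S)"
    unfolding lead_at_def using Max_in[OF fin ne] Max_ge[OF fin] by force
  moreover have "Max ?S \<in> I" using Max_in[OF fin ne] \<open>?S \<subseteq> I\<close> by auto
  ultimately show thesis using that by blast
qed

text \<open>The index of a member is its lead, so the leads are distinct and nothing can cancel the
  top coordinate contributed by the largest index with nonzero coefficient.\<close>

lemma lead_sum:
  assumes "finite L" "\<And>l. l \<in> L \<Longrightarrow> lead_at (x l) l" "\<exists>l\<in>L. c l \<noteq> 0"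
  obtains k where "k \<in> L" "lead_at (\<Sum>l\<in>L. sc (c l) (x l)) k"
proof -
  let ?S = "{l\<in>L. c l \<noteq> 0}"
  define k where "k = Max ?S"
  have fin: "finite ?S" and ne: "?S \<noteq> {}" using assms by auto
  have k: "k \<in> L" "c k \<noteq> 0" using Max_in[OF fin ne] by (auto simp: k_def)
  have big: "c l = 0" if "l \<in> L" "l > k" for l
    using Max_ge[OF fin, of l] that by (force simp: k_def)
  have low: "c l * x l i = 0" if "l \<in> L" "i \<ge> k" "l \<noteq> k \<or> i > k" for l i
    using assms(2)[OF that(1)] big[OF that(1)] that unfolding lead_at_def
    by (metis mult_eq_0_iff le_neq_implies_less linorder_neqE_nat order.strict_trans2)
  have "(\<Sum>l\<in>L. sc (c l) (x l)) k = (\<Sum>l\<in>L. if l = k then c k * x k k else 0)"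
    unfolding sum_fun_app by (rule sum.cong) (use low in \<open>auto simp: sc_apply\<close>)
  also have "\<dots> = c k * x k k" using k assms(1) by simp
  finally have "lead_at (\<Sum>l\<in>L. sc (c l) (x l)) k"
    unfolding lead_at_def using k assms(2)[OF k(1)] low
    by (auto simp: sum_fun_app sc_apply lead_at_def intro!: sum.neutral)
  with k show thesis using that by blast
qed

lemma lead_family_trivial:
  assumes "finite L" "\<And>l. l \<in> L \<Longrightarrow> lead_at (x l) l" "(\<Sum>l\<in>L. sc (c l) (x l)) = 0"
  shows "\<forall>l\<in>L. c l = 0"
proof (rule ccontr)
  assume "\<not> (\<forall>l\<in>L. c l = 0)"
  then obtain k where "lead_at (\<Sum>l\<in>L. sc (c l) (x l)) k"
    using lead_sum[OF assms(1,2)] by blast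
  with assms(3) show False by (simp add: lead_at_def)
qed

lemma leads_span:
  assumes "finite L" "\<And>l. l \<in> L \<Longrightarrow> lead_at (x l) l"
  shows "leads (vspan (x ` L)) = L"
proof
  show "L \<subseteq> leads (vspan (x ` L))"
    using assms(2) V.span_base unfolding leads_def by blast
  show "leads (vspan (x ` L)) \<subseteq> L"
  proof
    fix k assume "k \<in> leads (vspan (x ` L))"
    then obtain c where c: "lead_at (\<Sum>l\<in>L. sc (c l) (x l)) k"
      unfolding leads_def span_family[OF assms(1)] by auto
    then have "\<exists>l\<in>L. c l \<noteq> 0"
      by (auto simp: lead_at_def sum_fun_app sc_apply intro: ccontr)
    then show "k \<in> L"
      using lead_sum[OF assms(1,2)] lead_at_unique c by metis
  qed
qed

lemma leads_subset: "U \<subseteq> coord I \<Longrightarrow> leads U \<subseteq> I"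
  by (auto simp: leads_def lead_at_def coord_def)

lemma leads_mono: "U \<subseteq> U' \<Longrightarrow> leads U \<subseteq> leads U'"
  by (auto simp: leads_def)

text \<open>Elimination from the top coordinate downwards: if y vanishes from position
  \<open>Suc k\<close> on and y k is nonzero, then k is a lead of U, and subtracting a multiple of x
  k lowers the bound.\<close>

lemma lead_family_spans:
  assumes U: "vsubspace U" "U \<subseteq> coord {1..N}"
    and x: "\<And>l. l \<in> leads U \<Longrightarrow> x l \<in> U \<and> lead_at (x l) l"
  shows "vspan (x ` leads U) = U"
proof
  show "vspan (x ` leads U) \<subseteq> U"
    using x U by (intro V.span_minimal) auto
  have "y \<in> vspan (x ` leads U)" if "y \<in> U" "\<forall>i\<ge>k. y i = 0" for y k
    using that
  proof (induction k arbitrary: y)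
    case 0
    then have "y = 0" by (auto simp: fun_eq_iff)
    then show ?case by (metis V.span_zero)
  next
    case (Suc k)
    show ?case
    proof (cases "y k = 0")
      case True
      then have "\<forall>i\<ge>k. y i = 0" using Suc.prems by (metis le_antisym not_less_eq_eq)
      then show ?thesis using Suc by blast
    next
      case False
      then have k: "k \<in> leads U"
        using Suc.prems unfolding leads_def lead_at_def by (auto simp: Suc_le_eq)
      define c where "c = y k / x k k"
      have "y - sc c (x k) \<in> U"
        using k x Suc.prems U by (auto intro: V.subspace_diff V.subspace_scale)
      moreover have "(y - sc c (x k)) i = 0" if "i \<ge> k" for i
        using x[OF k] Suc.prems(2) that unfolding lead_at_def c_def
        by (cases "i = k") (auto simp: sc_apply)
      ultimately have "y - sc c (x k) \<in> vspan (x ` leads U)"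
        using Suc.IH by blast
      moreover have "sc c (x k) \<in> vspan (x ` leads U)"
        using k by (auto intro: V.span_scale V.span_base)
      ultimately have "(y - sc c (x k)) + sc c (x k) \<in> vspan (x ` leads U)"
        by (rule V.span_add)
      then show ?thesis by simp
    qed
  qed
  moreover have "\<forall>i\<ge>Suc N. y i = 0" if "y \<in> U" for y
    using that U by (auto simp: coord_def)
  ultimately show "U \<subseteq> vspan (x ` leads U)" by blast
qed

lemma lead_family:
  obtains x where "\<And>l. l \<in> leads U \<Longrightarrow> x l \<in> U \<and> lead_at (x l) l"
proof -
  have "\<forall>l\<in>leads U. \<exists>y. y \<in> U \<and> lead_at y l" by (auto simp: leads_def)
  then show thesis using that by metis
qed

lemma dim_leads:
  assumes U: "vsubspace U" "U \<subseteq> coord {1..N}"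
  shows "vdim U = card (leads U)"
proof -
  obtain x where x: "\<And>l. l \<in> leads U \<Longrightarrow> x l \<in> U \<and> lead_at (x l) l"
    using lead_family by blast
  have fin: "finite (leads U)"
    using leads_subset[OF U(2)] finite_subset by blast
  have "inj_on x (leads U)" "V.independent (x ` leads U)"
    using independent_family[OF fin] lead_family_trivial[OF fin] x by metis+
  moreover have "vspan (x ` leads U) = U" using lead_family_spans[OF U x] .
  ultimately show ?thesis
    by (metis V.dim_span_eq_card_independent card_image)
qed

text \<open>A family realizing the leads of the smaller space also realizes those of the larger one,
  and it spans both.\<close>

lemma eq_by_leads:
  assumes "vsubspace U" "vsubspace U'" "U' \<subseteq> coord {1..N}" "U \<subseteq> U'" "leads U = leads U'"
  shows "U = U'"
proof -
  obtain x where x: "\<And>l. l \<in> leads U \<Longrightarrow> x l \<in> U \<and> lead_at (x l) l"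
    using lead_family by blast
  have "vspan (x ` leads U) = U"
    using lead_family_spans[OF assms(1) _ x] assms by blast
  moreover have "vspan (x ` leads U') = U'"
    using lead_family_spans[OF assms(2,3), of x] x assms by auto
  ultimately show ?thesis by (metis assms(5))
qed

lemma lead_at_bvec: "lead_at (bvec k) k"
  by (simp add: lead_at_def bvec_def)

lemma subspace_coord: "vsubspace (coord I)"
  by (auto simp: V.subspace_def coord_def sc_apply)

lemma span_bvec:
  assumes "finite I"
  shows "vspan (bvec ` I) = coord I"
proof
  show "vspan (bvec ` I) \<subseteq> coord I"
    by (intro V.span_minimal subspace_coord) (auto simp: coord_def bvec_def)
  show "coord I \<subseteq> vspan (bvec ` I)"
  proof
    fix y assume y: "y \<in> coord I"
    have "y = (\<Sum>k\<in>I. sc (y k) (bvec k))"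
    proof
      fix i
      have "(\<Sum>k\<in>I. sc (y k) (bvec k)) i = (\<Sum>k\<in>I. if k = i then y i else 0)"
        unfolding sum_fun_app by (rule sum.cong) (auto simp: bvec_def sc_apply)
      then show "y i = (\<Sum>k\<in>I. sc (y k) (bvec k)) i"
        using y assms by (auto simp: coord_def)
    qed
    then show "y \<in> vspan (bvec ` I)"
      by (metis (no_types, lifting) V.span_sum V.span_scale V.span_base imageI)
  qed
qed

lemma std_span_eq: "std_span k = coord {1..k}"
  by (simp add: std_span_def span_bvec)

lemma leads_coord: "finite I \<Longrightarrow> leads (coord I) = I"
  using leads_span[of I bvec] by (simp add: lead_at_bvec span_bvec)

lemma subset_coord_iff_leads:
  assumes "vsubspace U" "U \<subseteq> coord {1..N}"
  shows "U \<subseteq> coord {1..k} \<longleftrightarrow> leads U \<subseteq> {1..k}"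
proof
  assume L: "leads U \<subseteq> {1..k}"
  show "U \<subseteq> coord {1..k}"
  proof
    fix y assume y: "y \<in> U"
    show "y \<in> coord {1..k}"
    proof (cases "y = 0")
      case True then show ?thesis by (simp add: coord_def)
    next
      case False
      then obtain l where l: "lead_at y l" using exists_lead y assms by blast
      with y L have "l \<le> k" by (auto simp: leads_def)
      then have "y i = 0" if "i > k" for i using l that by (auto simp: lead_at_def)
      \<comment> \<open>Vectors are functions on all natural numbers. The lead bounds the support
        only from above; coordinate 0 is excluded by the ambient space.\<close>
      moreover have "y 0 = 0" using y assms by (auto simp: coord_def)
      ultimately show ?thesis by (auto simp: coord_def Suc_le_eq not_le)
    qed
  qed
qed (rule leads_subset)

text \<open>A vector of U with lead at most k lies in \<open>coord {1..k}\<close>, so the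
  intersection of U with this space already has all k leads, and \<open>eq_by_leads\<close> makes it
  the whole space.\<close>

lemma coord_subset_iff_leads:
  assumes "vsubspace U" "U \<subseteq> coord {1..N}"
  shows "coord {1..k} \<subseteq> U \<longleftrightarrow> {1..k} \<subseteq> leads U"
proof
  assume "coord {1..k} \<subseteq> U"
  then show "{1..k} \<subseteq> leads U" using leads_mono leads_coord by blast
next
  assume L: "{1..k} \<subseteq> leads U"
  let ?V = "U \<inter> coord {1..k}"
  have "leads ?V = leads (coord {1..k})"
  proof
    show "leads ?V \<subseteq> leads (coord {1..k})" by (rule leads_mono) auto
    show "leads (coord {1..k}) \<subseteq> leads ?V"
    proof
      fix l assume "l \<in> leads (coord {1..k})"
      then have l: "l \<in> {1..k}" using leads_coord by auto
      then obtain y where y: "y \<in> U" "lead_at y l" using L by (auto simp: leads_def)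
      have "y 0 = 0" using y assms by (auto simp: coord_def)
      then have "y \<in> coord {1..k}"
        using y l by (auto simp: coord_def lead_at_def Suc_le_eq not_le)
      with y show "l \<in> leads ?V" by (auto simp: leads_def)
    qed
  qed
  then have "?V = coord {1..k}"
    using eq_by_leads[of ?V "coord {1..k}" k] V.subspace_inter assms subspace_coord by auto
  then show "coord {1..k} \<subseteq> U" by blast
qed

section \<open>Frames, orbits and cells\<close>

definition colv :: "matr \<Rightarrow> nat \<Rightarrow> vect" where
  "colv g k = (\<lambda>i. g (i, k))"

text \<open>The first F columns span the space of dimension F in the flag of g, and \<rho> lists the
  chosen rows. Any function is allowed: the order of the rows affects only the sign of the
  determinant, a repeated row makes it 0. \<open>Suc\<close> translates 0-based matrix indices to
  columns numbered from 1.\<close>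

definition minor_mat :: "(nat \<Rightarrow> nat) \<Rightarrow> nat \<Rightarrow> matr \<Rightarrow> complex mat" where
  "minor_mat \<rho> F g = mat F F (\<lambda>(i,j). g (\<rho> i, Suc j))"

lemma minor_mat_carrier [simp]: "minor_mat \<rho> F g \<in> carrier_mat F F"
  by (simp add: minor_mat_def)

lemma sum_upto_Suc: "(\<Sum>j\<in>{1..F}. h j) = (\<Sum>j\<in>{0..<F}. h (Suc j))"
  by (metis One_nat_def atLeastLessThanSuc_atLeastAtMost sum.shift_bounds_Suc_ivl)

lemma minor_zero_iff:
  "det (minor_mat \<rho> F g) = 0 \<longleftrightarrow>
    (\<exists>c. (\<exists>j\<in>{1..F}. c j \<noteq> 0) \<and> (\<forall>i<F. (\<Sum>j\<in>{1..F}. g (\<rho> i, j) * c j) = 0))"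
proof -
  have mv: "(minor_mat \<rho> F g *\<^sub>v v) $ i = (\<Sum>j\<in>{0..<F}. g (\<rho> i, Suc j) * v $ j)"
    if "v \<in> carrier_vec F" "i < F" for v i
    using that by (auto simp: minor_mat_def scalar_prod_def)
  show ?thesis
    unfolding det_0_iff_vec_prod_zero[OF minor_mat_carrier]
  proof
    assume "\<exists>v. v \<in> carrier_vec F \<and> v \<noteq> 0\<^sub>v F \<and> minor_mat \<rho> F g *\<^sub>v v = 0\<^sub>v F"
    then obtain v where v: "v \<in> carrier_vec F" "v \<noteq> 0\<^sub>v F" "minor_mat \<rho> F g *\<^sub>v v = 0\<^sub>v F" by blast
    from v(1,2) obtain j where j: "j < F" "v $ j \<noteq> 0"
      by (metis carrier_vecD eq_vecI index_zero_vec)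
    let ?c = "\<lambda>j. v $ (j - 1)"
    have "\<exists>j\<in>{1..F}. ?c j \<noteq> 0" using j by (intro bexI[of _ "Suc j"]) auto
    moreover have "(\<Sum>j\<in>{1..F}. g (\<rho> i, j) * ?c j) = 0" if "i < F" for i
      unfolding sum_upto_Suc using mv[OF v(1) that] v(3) that by simp
    ultimately show "\<exists>c. (\<exists>j\<in>{1..F}. c j \<noteq> 0) \<and> (\<forall>i<F. (\<Sum>j\<in>{1..F}. g (\<rho> i, j) * c j) = 0)"
      by (intro exI[of _ ?c]) blast
  next
    assume "\<exists>c. (\<exists>j\<in>{1..F}. c j \<noteq> 0) \<and> (\<forall>i<F. (\<Sum>j\<in>{1..F}. g (\<rho> i, j) * c j) = 0)"
    then obtain c j where c: "j \<in> {1..F}" "c j \<noteq> 0" "\<And>i. i < F \<Longrightarrow> (\<Sum>j\<in>{1..F}. g (\<rho> i, j) * c j) = 0"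
      by blast
    let ?v = "vec F (\<lambda>j. c (Suc j))"
    have "?v $ (j - 1) \<noteq> 0\<^sub>v F $ (j - 1)" using c(1,2) by auto
    then have "?v \<noteq> 0\<^sub>v F" by metis
    moreover have "minor_mat \<rho> F g *\<^sub>v ?v = 0\<^sub>v F"
    proof (rule eq_vecI)
      fix i assume "i < dim_vec (0\<^sub>v F :: complex vec)"
      then have "i < F" by simp
      then show "(minor_mat \<rho> F g *\<^sub>v ?v) $ i = 0\<^sub>v F $ i"
        using mv[of ?v i] c(3)[of i, unfolded sum_upto_Suc] by simp
    qed (simp add: minor_mat_def)
    ultimately show "\<exists>v. v \<in> carrier_vec F \<and> v \<noteq> 0\<^sub>v F \<and> minor_mat \<rho> F g *\<^sub>v v = 0\<^sub>v F"
      by (intro exI[of _ ?v]) auto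
  qed
qed

text \<open>A test for invertibility that asks for no explicit inverse. In the converse direction a
  trivial kernel makes the determinant nonzero, and the adjugate supplies the inverse.\<close>

lemma GL_iff_kernel:
  "g \<in> GL N \<longleftrightarrow> mat_supp N g \<and>
    (\<forall>c. (\<forall>i\<in>{1..N}. (\<Sum>j\<in>{1..N}. g (i,j) * c j) = 0) \<longrightarrow> (\<forall>j\<in>{1..N}. c j = 0))"
proof
  assume "g \<in> GL N"
  then obtain h where g: "mat_supp N g" and h: "mmul N h g = idm N" by (auto simp: GL_def)
  have "c k = 0" if c: "\<forall>i\<in>{1..N}. (\<Sum>j\<in>{1..N}. g (i,j) * c j) = 0" and k: "k \<in> {1..N}" for c k
  proof -
    have "c k = (\<Sum>j\<in>{1..N}. idm N (k,j) * c j)"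
      using k by (simp add: idm_def if_distrib[of "\<lambda>x. x * _"] cong: if_cong)
    also have "\<dots> = (\<Sum>j\<in>{1..N}. (\<Sum>i\<in>{1..N}. h (k,i) * g (i,j)) * c j)"
      unfolding h[symmetric] by (simp add: mmul_def)
    also have "\<dots> = (\<Sum>j\<in>{1..N}. \<Sum>i\<in>{1..N}. h (k,i) * (g (i,j) * c j))"
      by (simp add: sum_distrib_right mult.assoc)
    also have "\<dots> = (\<Sum>i\<in>{1..N}. \<Sum>j\<in>{1..N}. h (k,i) * (g (i,j) * c j))"
      by (rule sum.swap)
    also have "\<dots> = (\<Sum>i\<in>{1..N}. h (k,i) * (\<Sum>j\<in>{1..N}. g (i,j) * c j))"
      by (simp add: sum_distrib_left)
    also have "\<dots> = 0" using c by (intro sum.neutral) auto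
    finally show ?thesis .
  qed
  with g show "mat_supp N g \<and>
    (\<forall>c. (\<forall>i\<in>{1..N}. (\<Sum>j\<in>{1..N}. g (i,j) * c j) = 0) \<longrightarrow> (\<forall>j\<in>{1..N}. c j = 0))" by blast
next
  assume A: "mat_supp N g \<and>
    (\<forall>c. (\<forall>i\<in>{1..N}. (\<Sum>j\<in>{1..N}. g (i,j) * c j) = 0) \<longrightarrow> (\<forall>j\<in>{1..N}. c j = 0))"
  let ?A = "minor_mat Suc N g"
  have d: "det ?A \<noteq> 0"
  proof
    assume "det ?A = 0"
    then obtain c where c: "\<exists>j\<in>{1..N}. c j \<noteq> 0"
      "\<forall>i<N. (\<Sum>j\<in>{1..N}. g (Suc i, j) * c j) = 0"
      unfolding minor_zero_iff by blast
    have "(\<Sum>j\<in>{1..N}. g (i, j) * c j) = 0" if "i \<in> {1..N}" for i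
      using c(2)[rule_format, of "i - 1"] that by (cases i) auto
    with A c(1) show False by blast
  qed
  \<comment> \<open>Adjugate over determinant, shifted to indices starting at 1 and extended by 0 so
    that \<open>mat_supp\<close> holds.\<close>
  define h where "h = (\<lambda>(i,j). if i \<in> {1..N} \<and> j \<in> {1..N}
    then adj_mat ?A $$ (i - 1, j - 1) / det ?A else 0)"
  note adj = adj_mat[OF minor_mat_carrier[of Suc N g]]
  have h: "mat_supp N h" by (auto simp: mat_supp_def h_def split: if_splits)
  have "mmul N g h (i,j) = idm N (i,j)" for i j
  proof (cases "i \<in> {1..N} \<and> j \<in> {1..N}")
    case True
    have "(\<Sum>k\<in>{0..<N}. g (i, Suc k) * adj_mat ?A $$ (k, j - 1)) = (?A * adj_mat ?A) $$ (i - 1, j - 1)"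
      using True adj(1) by (auto simp: scalar_prod_def minor_mat_def)
    also have "\<dots> = (if i = j then det ?A else 0)"
      unfolding adj(2) using True by auto
    finally have "(\<Sum>k\<in>{0..<N}. g (i, Suc k) * adj_mat ?A $$ (k, j - 1)) / det ?A = (if i = j then 1 else 0)"
      using d by simp
    moreover have "mmul N g h (i,j) = (\<Sum>k\<in>{0..<N}. g (i, Suc k) * (adj_mat ?A $$ (k, j - 1) / det ?A))"
      unfolding mmul_def prod.case sum_upto_Suc using True by (simp add: h_def)
    ultimately show ?thesis using True by (simp add: idm_def sum_divide_distrib)
  next
    case False
    then show ?thesis using A by (auto simp: mmul_def idm_def h_def mat_supp_def intro!: sum.neutral)
  qed
  moreover have "mmul N h g (i,j) = idm N (i,j)" for i j
  proof (cases "i \<in> {1..N} \<and> j \<in> {1..N}")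
    case True
    have "(\<Sum>k\<in>{0..<N}. adj_mat ?A $$ (i - 1, k) * g (Suc k, j)) = (adj_mat ?A * ?A) $$ (i - 1, j - 1)"
      using True adj(1) by (auto simp: scalar_prod_def minor_mat_def)
    also have "\<dots> = (if i = j then det ?A else 0)"
      unfolding adj(3) using True by auto
    finally have "(\<Sum>k\<in>{0..<N}. adj_mat ?A $$ (i - 1, k) * g (Suc k, j)) / det ?A = (if i = j then 1 else 0)"
      using d by simp
    moreover have "mmul N h g (i,j) = (\<Sum>k\<in>{0..<N}. adj_mat ?A $$ (i - 1, k) * g (Suc k, j) / det ?A)"
      unfolding mmul_def prod.case sum_upto_Suc using True by (simp add: h_def)
    ultimately show ?thesis using True by (simp add: idm_def sum_divide_distrib)
  next
    case False
    then show ?thesis using A by (auto simp: mmul_def idm_def h_def mat_supp_def intro!: sum.neutral)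
  qed
  ultimately have "mmul N g h = idm N" "mmul N h g = idm N" by auto
  with A h show "g \<in> GL N" unfolding GL_def by blast
qed

lemma mat_supp_mmul: "mat_supp N g \<Longrightarrow> mat_supp N h \<Longrightarrow> mat_supp N (mmul N g h)"
proof -
  assume gh: "mat_supp N g" "mat_supp N h"
  have "mmul N g h (i,j) = 0" if "i \<notin> {1..N} \<or> j \<notin> {1..N}" for i j
  proof -
    have "g (i,k) * h (k,j) = 0" for k using gh that unfolding mat_supp_def by (metis mult_eq_0_iff)
    then show ?thesis by (simp add: mmul_def del: mult_eq_0_iff)
  qed
  then show ?thesis unfolding mat_supp_def by blast
qed

lemma mmul_GL:
  assumes "g \<in> GL N" "h \<in> GL N"
  shows "mmul N g h \<in> GL N"
  unfolding GL_iff_kernel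
proof (intro conjI allI impI)
  show "mat_supp N (mmul N g h)" using assms mat_supp_mmul by (simp add: GL_def)
  fix c assume c: "\<forall>i\<in>{1..N}. (\<Sum>j\<in>{1..N}. mmul N g h (i,j) * c j) = 0"
  have "(\<Sum>j\<in>{1..N}. mmul N g h (i,j) * c j) = (\<Sum>k\<in>{1..N}. g (i,k) * (\<Sum>j\<in>{1..N}. h (k,j) * c j))" for i
  proof -
    have "(\<Sum>j\<in>{1..N}. mmul N g h (i,j) * c j) = (\<Sum>j\<in>{1..N}. \<Sum>k\<in>{1..N}. g (i,k) * (h (k,j) * c j))"
      by (simp add: mmul_def sum_distrib_right mult.assoc)
    also have "\<dots> = (\<Sum>k\<in>{1..N}. \<Sum>j\<in>{1..N}. g (i,k) * (h (k,j) * c j))" by (rule sum.swap)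
    finally show ?thesis by (simp add: sum_distrib_left)
  qed
  with c have "\<forall>i\<in>{1..N}. (\<Sum>k\<in>{1..N}. g (i,k) * (\<Sum>j\<in>{1..N}. h (k,j) * c j)) = 0" by simp
  then have "\<forall>k\<in>{1..N}. (\<Sum>j\<in>{1..N}. h (k,j) * c j) = 0"
    using assms(1) unfolding GL_iff_kernel by fast
  then show "\<forall>j\<in>{1..N}. c j = 0"
    using assms(2) unfolding GL_iff_kernel by fast
qed

lemma mvec_module_hom: "module_hom sc sc (mvec N b)"
  by unfold_locales
    (auto simp: mvec_def sc_def fun_eq_iff algebra_simps sum.distrib sum_distrib_left)

lemma mvec_span: "mvec N b ` vspan S = vspan (mvec N b ` S)"
  by (rule module_hom.span_image[OF mvec_module_hom, symmetric])

lemma mvec_colv: "mvec N b (colv g k) = colv (mmul N b g) k"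
  by (simp add: mvec_def colv_def mmul_def)

lemma frame_eq: "frame N n f g a = (if a \<in> {1..n} then vspan (colv g ` {1..f a}) else {0})"
  by (simp add: frame_def colv_def)

text \<open>The action becomes left multiplication of frames, so the Borel orbit of p(w) consists of
  the flags of the products of b in \<open>Borel N\<close> with the permutation matrix of w.\<close>

lemma act_frame: "act N b (frame N n f g) = frame N n f (mmul N b g)"
proof
  fix a
  have "mvec N b ` {0} = {0}" by (auto simp: mvec_def fun_eq_iff)
  then show "act N b (frame N n f g) a = frame N n f (mmul N b g) a"
    by (simp add: act_def frame_eq mvec_span image_image mvec_colv)
qed

definition perm_mat :: "nat \<Rightarrow> (nat \<Rightarrow> nat) \<Rightarrow> matr" where
  "perm_mat N w = (\<lambda>(i,k). if k \<in> {1..N} \<and> i = w k then 1 else 0)"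

lemma perm_mat_GL:
  assumes "w permutes {1..N}"
  shows "perm_mat N w \<in> GL N"
  unfolding GL_iff_kernel
proof (intro conjI allI impI ballI)
  show "mat_supp N (perm_mat N w)"
    using permutes_in_image[OF assms]
    by (auto simp: mat_supp_def perm_mat_def simp del: atLeastAtMost_iff split: if_splits)
  fix c j
  assume c: "\<forall>i\<in>{1..N}. (\<Sum>j\<in>{1..N}. perm_mat N w (i,j) * c j) = 0" and j: "j \<in> {1..N}"
  have "(\<Sum>k\<in>{1..N}. perm_mat N w (w j,k) * c k) = (\<Sum>k\<in>{1..N}. if k = j then c j else 0)"
    by (rule sum.cong) (use permutes_inj[OF assms] in \<open>auto simp: perm_mat_def dest: injD\<close>)
  also have "\<dots> = c j" using j by simp
  finally show "c j = 0" using c j assms by (metis permutes_in_image)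
qed

lemma colv_mmul_perm_mat:
  assumes "w permutes {1..N}" "k \<in> {1..N}"
  shows "colv (mmul N b (perm_mat N w)) k = colv b (w k)"
proof
  fix i
  have "(\<Sum>l\<in>{1..N}. b (i,l) * perm_mat N w (l,k)) = (\<Sum>l\<in>{1..N}. if l = w k then b (i, w k) else 0)"
    by (rule sum.cong) (use assms in \<open>auto simp: perm_mat_def\<close>)
  also have "\<dots> = b (i, w k)" using assms permutes_in_image[OF assms(1)] by simp
  finally show "colv (mmul N b (perm_mat N w)) k i = colv b (w k) i"
    by (simp add: colv_def mmul_def)
qed

lemma colspan_GL:
  assumes g: "g \<in> GL N" and F: "F \<le> N"
  shows "vspan (colv g ` {1..F}) \<subseteq> coord {1..N}"
    and "(\<Sum>j\<in>{1..F}. sc (c j) (colv g j)) = 0 \<Longrightarrow> \<forall>j\<in>{1..F}. c j = 0"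
    and "vdim (vspan (colv g ` {1..F})) = F"
proof -
  show "vspan (colv g ` {1..F}) \<subseteq> coord {1..N}"
    using g by (intro V.span_minimal subspace_coord) (auto simp: coord_def colv_def GL_def mat_supp_def)
  have triv: "\<forall>j\<in>{1..F}. c j = 0" if z: "(\<Sum>j\<in>{1..F}. sc (c j) (colv g j)) = 0" for c
  proof -
    \<comment> \<open>Padding with zeros turns a relation between the first F columns into a kernel
      vector of g.\<close>
    let ?c = "\<lambda>j. if j \<in> {1..F} then c j else 0"
    have "(\<Sum>j\<in>{1..N}. g (i,j) * ?c j) = 0" for i
    proof -
      have "(\<Sum>j\<in>{1..N}. g (i,j) * ?c j) = (\<Sum>j\<in>{1..F}. g (i,j) * ?c j)"
        using F by (intro sum.mono_neutral_right) auto
      also have "\<dots> = (\<Sum>j\<in>{1..F}. sc (c j) (colv g j)) i"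
        by (simp add: sum_fun_app sc_apply colv_def mult.commute)
      finally show ?thesis using z by simp
    qed
    then have z2: "\<forall>i\<in>{1..N}. (\<Sum>j\<in>{1..N}. g (i,j) * ?c j) = 0" by blast
    have "\<forall>j\<in>{1..N}. ?c j = 0"
      using g[unfolded GL_iff_kernel, THEN conjunct2, THEN spec, of ?c] z2 by (rule mp)
    then show ?thesis using F by force
  qed
  then show "(\<Sum>j\<in>{1..F}. sc (c j) (colv g j)) = 0 \<Longrightarrow> \<forall>j\<in>{1..F}. c j = 0" .
  have "inj_on (colv g) {1..F}" "V.independent (colv g ` {1..F})"
    using independent_family[of "{1..F}" "colv g", OF _ triv] by simp_all
  then show "vdim (vspan (colv g ` {1..F})) = F"
    by (metis V.dim_span_eq_card_independent card_image card_atLeastAtMost diff_Suc_1)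
qed

text \<open>A zero at (k,k) would confine the first k columns to a space of dimension k - 1,
  although they are independent.\<close>

lemma Borel_lead:
  assumes b: "b \<in> Borel N" and k: "k \<in> {1..N}"
  shows "lead_at (colv b k) k"
proof -
  have g: "b \<in> GL N" and up: "\<And>i j. j < i \<Longrightarrow> b (i,j) = 0" using b by (auto simp: Borel_def)
  have "b (k,k) \<noteq> 0"
  proof
    assume z: "b (k,k) = 0"
    have "colv b j \<in> coord {1..k-1}" if j: "j \<in> {1..k}" for j
    proof -
      have "b (i,j) = 0" if "i \<notin> {1..k-1}" for i
        using g up[of j i] z j that unfolding GL_def mat_supp_def
        by (cases "i = k"; cases "j = k") (auto simp: not_le)
      then show ?thesis by (auto simp: coord_def colv_def)
    qed
    then have sub: "vspan (colv b ` {1..k}) \<subseteq> coord {1..k-1}"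
      by (intro V.span_minimal subspace_coord) auto
    have "k = vdim (vspan (colv b ` {1..k}))" using colspan_GL(3)[OF g] k by simp
    also have "\<dots> = card (leads (vspan (colv b ` {1..k})))"
      using dim_leads[OF V.subspace_span sub] .
    also have "\<dots> \<le> card {1..k-1}"
      using leads_subset[OF sub] by (intro card_mono) auto
    finally have "k \<le> k - 1" by simp
    then show False using k unfolding atLeastAtMost_iff by linarith
  qed
  then show ?thesis using up by (auto simp: lead_at_def colv_def)
qed

lemma BorelI:
  assumes "mat_supp N b" "\<And>k. k \<in> {1..N} \<Longrightarrow> lead_at (colv b k) k"
  shows "b \<in> Borel N"
proof -
  have "\<forall>j\<in>{1..N}. c j = 0" if c: "\<forall>i\<in>{1..N}. (\<Sum>j\<in>{1..N}. b (i,j) * c j) = 0" for c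
  proof -
    have "(\<Sum>j\<in>{1..N}. b (i,j) * c j) = 0" for i
    proof (cases "i \<in> {1..N}")
      case False
      then have "b (i,j) = 0" for j using assms(1) unfolding mat_supp_def by blast
      then show ?thesis by simp
    qed (use c in blast)
    then have "(\<Sum>j\<in>{1..N}. sc (c j) (colv b j)) = 0"
      by (auto simp: fun_eq_iff sum_fun_app sc_apply colv_def mult.commute)
    then show ?thesis using lead_family_trivial[of "{1..N}" "colv b" c] assms(2) by blast
  qed
  then have "b \<in> GL N" using assms(1) unfolding GL_iff_kernel by blast
  moreover have "b (i,j) = 0" if "j < i" for i j
  proof (cases "j \<in> {1..N}")
    case True then show ?thesis using assms(2)[OF True] that by (auto simp: lead_at_def colv_def)
  next
    case False then show ?thesis using assms(1) unfolding mat_supp_def by blast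
  qed
  ultimately show ?thesis by (auto simp: Borel_def)
qed

section \<open>Partial flags and the cells cut out by their leads\<close>

locale flag_type =
  fixes N n :: nat and f :: "nat \<Rightarrow> nat"
  assumes f_Suc: "\<And>a. a \<in> {1..<n} \<Longrightarrow> f a \<le> f (Suc a)"
    and f_le: "\<And>a. a \<in> {1..n} \<Longrightarrow> f a \<le> N"
begin

lemma f_mono: "a \<in> {1..n} \<Longrightarrow> b \<in> {1..n} \<Longrightarrow> a \<le> b \<Longrightarrow> f a \<le> f b"
proof (induction b)
  case (Suc b)
  then show ?case
    by (cases "a = Suc b") (use f_Suc[of b] in force)+
qed simp

lemma Fl_D:
  assumes "U \<in> Fl N n f" "a \<in> {1..n}"
  shows "vsubspace (U a)" "U a \<subseteq> coord {1..N}" "card (leads (U a)) = f a"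
  using assms dim_leads[of "U a" N] by (auto simp: Fl_def std_span_eq)

lemma Fl_mono:
  assumes U: "U \<in> Fl N n f"
  shows "a \<in> {1..n} \<Longrightarrow> b \<in> {1..n} \<Longrightarrow> a \<le> b \<Longrightarrow> U a \<subseteq> U b"
proof (induction b)
  case (Suc b)
  show ?case
  proof (cases "a = Suc b")
    case False
    then have "U a \<subseteq> U b" using Suc by auto
    also have "U b \<subseteq> U (Suc b)" using U Suc.prems False by (auto simp: Fl_def)
    finally show ?thesis .
  qed simp
qed simp

lemma frame_Fl:
  assumes g: "g \<in> GL N"
  shows "frame N n f g \<in> Fl N n f"
proof -
  have "frame N n f g a \<subseteq> frame N n f g (Suc a)" if a: "a \<in> {1..<n}" for a
  proof -
    have "vspan (colv g ` {1..f a}) \<subseteq> vspan (colv g ` {1..f (Suc a)})"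
      using f_Suc[OF a] by (intro V.span_mono image_mono) auto
    then show ?thesis using a by (simp add: frame_eq)
  qed
  moreover have "vsubspace (frame N n f g a) \<and> frame N n f g a \<subseteq> std_span N \<and> vdim (frame N n f g a) = f a"
    if a: "a \<in> {1..n}" for a
    using colspan_GL[OF g f_le[OF a]] a by (simp add: frame_eq std_span_eq del: One_nat_def)
  ultimately show ?thesis
    unfolding Fl_def by (simp add: frame_eq)
qed

lemma Fl_eq_by_leads:
  assumes "U \<in> Fl N n f" "U' \<in> Fl N n f"
    and "\<And>a. a \<in> {1..n} \<Longrightarrow> U a \<subseteq> U' a" "\<And>a. a \<in> {1..n} \<Longrightarrow> leads (U a) = leads (U' a)"
  shows "U = U'"
proof
  fix a
  show "U a = U' a"
  proof (cases "a \<in> {1..n}")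
    case True
    then show ?thesis
      using eq_by_leads[OF Fl_D(1)[OF assms(1)] Fl_D(1,2)[OF assms(2)] assms(3,4)] by blast
  next
    case False
    then show ?thesis using assms(1,2) by (auto simp: Fl_def)
  qed
qed

text \<open>Indexed by families of sets rather than by permutations: equivalent permutations share a
  cell, and families read off from a word or from a flag can be inserted directly.\<close>

definition cell :: "(nat \<Rightarrow> nat set) \<Rightarrow> flag set" where
  "cell I = {U \<in> Fl N n f. \<forall>a\<in>{1..n}. leads (U a) = I a}"

lemma cell_cong: "(\<And>a. a \<in> {1..n} \<Longrightarrow> I a = J a) \<Longrightarrow> cell I = cell J"
  by (auto simp: cell_def)

definition initial :: "(nat \<Rightarrow> nat) \<Rightarrow> nat \<Rightarrow> nat set" where
  "initial w a = w ` {1..f a}"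

lemma initial_mono: "a \<in> {1..n} \<Longrightarrow> b \<in> {1..n} \<Longrightarrow> a \<le> b \<Longrightarrow> initial w a \<subseteq> initial w b"
  unfolding initial_def using f_mono by (intro image_mono) auto

lemma pfl_frame:
  assumes "w permutes {1..N}"
  shows "pfl n f w = frame N n f (perm_mat N w)"
proof -
  have "colv (perm_mat N w) k = bvec (w k)" if "k \<in> {1..N}" for k
    using that by (auto simp: colv_def perm_mat_def bvec_def)
  then have "colv (perm_mat N w) ` {1..f a} = bvec ` w ` {1..f a}" if "a \<in> {1..n}" for a
    unfolding image_image using f_le[OF that] by (intro image_cong) auto
  then show ?thesis by (auto simp: pfl_def frame_eq fun_eq_iff)
qed

lemma frame_mmul_perm_mat:
  assumes "w permutes {1..N}" "a \<in> {1..n}"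
  shows "frame N n f (mmul N b (perm_mat N w)) a = vspan (colv b ` initial w a)"
proof -
  have "colv (mmul N b (perm_mat N w)) ` {1..f a} = colv b ` initial w a"
    unfolding initial_def image_image using f_le[OF assms(2)] colv_mmul_perm_mat[OF assms(1)]
    by (intro image_cong) auto
  then show ?thesis using assms by (simp add: frame_eq)
qed

lemma initial_subset: "w permutes {1..N} \<Longrightarrow> a \<in> {1..n} \<Longrightarrow> initial w a \<subseteq> {1..N}"
  unfolding initial_def using f_le[of a] permutes_in_image[of w "{1..N}"] by fastforce

lemma Borel_frame_cell:
  assumes w: "w permutes {1..N}" and b: "b \<in> Borel N"
  shows "frame N n f (mmul N b (perm_mat N w)) \<in> cell (initial w)"
proof -
  have "leads (vspan (colv b ` initial w a)) = initial w a" if "a \<in> {1..n}" for a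
    by (rule leads_span) (use initial_subset[OF w that] Borel_lead[OF b] in \<open>auto simp: initial_def\<close>)
  moreover have "mmul N b (perm_mat N w) \<in> GL N"
    using b perm_mat_GL[OF w] mmul_GL by (auto simp: Borel_def)
  ultimately show ?thesis
    unfolding cell_def using frame_Fl frame_mmul_perm_mat[OF w] by auto
qed

text \<open>The columns of b are chosen one by one: for each l a vector with lead l lying in every
  space of U that has l among its leads. The flag spanned by them is contained in U and has the same
  leads, so it equals U.\<close>

lemma cell_Borel_frame:
  assumes w: "w permutes {1..N}" and U: "U \<in> cell (initial w)"
  obtains b where "b \<in> Borel N" "U = frame N n f (mmul N b (perm_mat N w))"
proof -
  have UF: "U \<in> Fl N n f" and L: "\<And>a. a \<in> {1..n} \<Longrightarrow> leads (U a) = initial w a"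
    using U by (auto simp: cell_def)
  have "\<exists>x. lead_at x l \<and> x \<in> coord {1..N} \<and> (\<forall>a\<in>{1..n}. l \<in> initial w a \<longrightarrow> x \<in> U a)"
    if l: "l \<in> {1..N}" for l
  proof (cases "\<exists>a\<in>{1..n}. l \<in> initial w a")
    case True
    \<comment> \<open>A vector chosen in the smallest space with lead l lies in all the larger
      ones.\<close>
    define a where "a = (LEAST a. a \<in> {1..n} \<and> l \<in> initial w a)"
    have a: "a \<in> {1..n}" "l \<in> initial w a"
      using True LeastI_ex[of "\<lambda>a. a \<in> {1..n} \<and> l \<in> initial w a"] unfolding a_def by blast+
    then obtain x where x: "x \<in> U a" "lead_at x l" using L[of a] by (auto simp: leads_def)
    have "x \<in> U b" if "b \<in> {1..n}" "l \<in> initial w b" for b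
    proof -
      have "a \<le> b" unfolding a_def using that by (intro Least_le) blast
      then show ?thesis using Fl_mono[OF UF a(1) that(1)] x by blast
    qed
    then show ?thesis using x Fl_D(2)[OF UF a(1)] by blast
  next
    \<comment> \<open>Such an l is a lead of no space of the flag; its column only completes b to an
      element of \<open>Borel N\<close>.\<close>
    case False
    then show ?thesis using l lead_at_bvec[of l] by (intro exI[of _ "bvec l"]) (auto simp: coord_def bvec_def)
  qed
  then obtain x where x: "\<And>l. l \<in> {1..N} \<Longrightarrow> lead_at (x l) l \<and> x l \<in> coord {1..N} \<and>
    (\<forall>a\<in>{1..n}. l \<in> initial w a \<longrightarrow> x l \<in> U a)" by metis
  define b :: matr where "b = (\<lambda>(i,l). if l \<in> {1..N} then x l i else 0)"
  have col: "colv b l = x l" if "l \<in> {1..N}" for l using that by (auto simp: colv_def b_def)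
  have "mat_supp N b" using x by (auto simp: mat_supp_def b_def coord_def split: if_splits)
  then have b: "b \<in> Borel N" using x col by (intro BorelI) auto
  let ?U = "frame N n f (mmul N b (perm_mat N w))"
  have c: "?U \<in> cell (initial w)" using Borel_frame_cell[OF w b] .
  have "?U = U"
  proof (rule Fl_eq_by_leads)
    show "?U \<in> Fl N n f" "U \<in> Fl N n f" using c UF by (auto simp: cell_def)
    fix a assume a: "a \<in> {1..n}"
    show "leads (?U a) = leads (U a)" using c L a by (auto simp: cell_def)
    show "?U a \<subseteq> U a"
      unfolding frame_mmul_perm_mat[OF w a] using x col initial_subset[OF w a] a Fl_D[OF UF a]
      by (intro V.span_minimal) auto
  qed
  with b show thesis using that by blast
qed

lemma Borbit_eq_cell:
  assumes w: "w permutes {1..N}"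
  shows "Borbit N n f w = cell (initial w)"
proof -
  have "act N b (pfl n f w) = frame N n f (mmul N b (perm_mat N w))" for b
    by (simp add: pfl_frame[OF w] act_frame)
  then have "Borbit N n f w = {frame N n f (mmul N b (perm_mat N w)) |b. b \<in> Borel N}"
    by (simp add: Borbit_def)
  also have "\<dots> = cell (initial w)"
  proof
    show "cell (initial w) \<subseteq> {frame N n f (mmul N b (perm_mat N w)) |b. b \<in> Borel N}"
    proof
      fix U assume "U \<in> cell (initial w)"
      then obtain b where "b \<in> Borel N" "U = frame N n f (mmul N b (perm_mat N w))"
        using cell_Borel_frame[OF w] by blast
      then show "U \<in> {frame N n f (mmul N b (perm_mat N w)) |b. b \<in> Borel N}" by blast
    qed
  qed (use Borel_frame_cell[OF w] in auto)
  finally show ?thesis .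
qed

lemma GrQR_iff:
  "U \<in> GrQR N n f r q \<longleftrightarrow>
    U \<in> Fl N n f \<and> (\<forall>a\<in>{1..n}. {1..q a} \<subseteq> leads (U a) \<and> leads (U a) \<subseteq> {1..r a})"
  unfolding GrQR_def std_span_eq mem_Collect_eq
  by (intro conj_cong ball_cong refl;
      rule coord_subset_iff_leads subset_coord_iff_leads; rule Fl_D; assumption)

end

section \<open>Zariski topology and irreducible components\<close>

lemma polyfn_sum: "(\<And>i. i \<in> S \<Longrightarrow> polyfn (p i)) \<Longrightarrow> polyfn (\<lambda>x. \<Sum>i\<in>S. p i x)"
proof (induction S rule: infinite_finite_induct)
  case (insert i S)
  then show ?case using padd[of "p i"] by simp
qed (simp_all add: pconst)

lemma polyfn_prod: "(\<And>i. i \<in> S \<Longrightarrow> polyfn (p i)) \<Longrightarrow> polyfn (\<lambda>x. \<Prod>i\<in>S. p i x)"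
proof (induction S rule: infinite_finite_induct)
  case (insert i S)
  then show ?case using pmult[of "p i"] by simp
qed (simp_all add: pconst)

lemma polyfn_subst:
  assumes "polyfn p" "\<And>i. polyfn (\<lambda>x. \<phi> x i)"
  shows "polyfn (\<lambda>x. p (\<phi> x))"
  using assms(1)
proof induction
  case (pvar i)
  show ?case by (rule assms(2))
qed (rule polyfn.intros; assumption)+

lemma polyfn_det:
  assumes "\<And>x. A x \<in> carrier_mat F F" "\<And>i j. i < F \<Longrightarrow> j < F \<Longrightarrow> polyfn (\<lambda>x. A x $$ (i,j))"
  shows "polyfn (\<lambda>x. det (A x))"
proof -
  have "polyfn (\<lambda>x. \<Sum>p\<in>{p. p permutes {0..<F}}. signof p * (\<Prod>i\<in>{0..<F}. A x $$ (i, p i)))"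
  proof (intro polyfn_sum pmult pconst polyfn_prod)
    fix p i assume "p \<in> {p. p permutes {0..<F}}" "i \<in> {0..<F}"
    then have "i < F" "p i < F" using permutes_in_image[of p "{0..<F}" i] by auto
    then show "polyfn (\<lambda>x. A x $$ (i, p i))" by (rule assms(2))
  qed
  moreover have "(\<lambda>x. det (A x)) =
      (\<lambda>x. \<Sum>p\<in>{p. p permutes {0..<F}}. signof p * (\<Prod>i\<in>{0..<F}. A x $$ (i, p i)))"
    using det_def'[OF assms(1)] by (intro ext) simp
  ultimately show ?thesis by simp
qed

lemma polyfn_minor: "polyfn (\<lambda>g. det (minor_mat \<rho> F g))"
  by (rule polyfn_det[of _ F]) (auto simp: minor_mat_def intro: pvar)

lemma polyfn_adj_minor:
  assumes "i < F" "j < F"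
  shows "polyfn (\<lambda>g. adj_mat (minor_mat \<rho> F g) $$ (i,j))"
proof -
  have "polyfn (\<lambda>g. (-1) ^ (j + i) * det (mat_delete (minor_mat \<rho> F g) j i))"
    by (intro pmult pconst polyfn_det[of _ "F - 1"])
      (auto simp: minor_mat_def mat_delete_def intro: pvar)
  then show ?thesis
    using assms by (simp add: adj_mat_def cofactor_def minor_mat_def)
qed

text \<open>Reduces vanishing questions to one variable, where a nonzero polynomial has finitely
  many zeros. The curves are lines in the proof of irreducibility and families of frames in the
  computation of closures.\<close>

lemma polyfn_curve:
  assumes "polyfn p" "\<And>i. \<exists>Q. \<forall>t. \<phi> t i = poly Q t"
  shows "\<exists>P. \<forall>t. p (\<phi> t) = poly P t"
  using assms(1)
proof induction
  case (pconst c)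
  show ?case by (intro exI[of _ "[:c:]"]) simp
next
  case (pvar i)
  show ?case by (rule assms(2))
next
  case (padd p q)
  then show ?case by (metis poly_add)
next
  case (pmult p q)
  then show ?case by (metis poly_mult)
qed

lemma poly_cofinite_zero:
  fixes P :: "complex poly"
  assumes "\<And>t. t \<noteq> 0 \<Longrightarrow> poly P t = 0"
  shows "P = 0"
proof (rule ccontr)
  assume "P \<noteq> 0"
  then have "finite (insert 0 {t. poly P t = 0})" using poly_roots_finite by auto
  moreover have "insert 0 {t. poly P t = 0} = UNIV" using assms by auto
  ultimately show False using infinite_UNIV_char_0 by metis
qed

text \<open>On the line through a point with p nonzero and a point with q nonzero, both restrict to
  nonzero polynomials in one variable, whose product cannot vanish.\<close>

lemma aff_prime:
  assumes p: "polyfn p" and q: "polyfn q" and "\<And>x. x \<in> aff d \<Longrightarrow> p x * q x = 0"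
  shows "(\<forall>x\<in>aff d. p x = 0) \<or> (\<forall>x\<in>aff d. q x = 0)"
proof (rule ccontr)
  assume "\<not> ?thesis"
  then obtain x y where x: "x \<in> aff d" "p x \<noteq> 0" and y: "y \<in> aff d" "q y \<noteq> 0" by blast
  define \<phi> where "\<phi> t i = x i + t * (y i - x i)" for t i
  have lin: "\<exists>Q. \<forall>t. \<phi> t i = poly Q t" for i
    by (rule exI[of _ "[:x i, y i - x i:]"]) (simp add: \<phi>_def)
  obtain P where P: "\<forall>t. p (\<phi> t) = poly P t" using polyfn_curve[OF p lin] ..
  obtain Q where Q: "\<forall>t. q (\<phi> t) = poly Q t" using polyfn_curve[OF q lin] ..
  have aff: "\<phi> t \<in> aff d" for t
  proof -
    have "\<phi> t i = 0" if "i \<notin> {1..d}" for i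
    proof -
      have "x i = 0" "y i = 0" using x(1) y(1) that by (auto simp: aff_def)
      then show ?thesis by (simp add: \<phi>_def)
    qed
    then show ?thesis by (auto simp: aff_def)
  qed
  have "\<phi> 0 = x" "\<phi> 1 = y" by (auto simp: \<phi>_def)
  then have "P \<noteq> 0" "Q \<noteq> 0" using P[rule_format, of 0] Q[rule_format, of 1] x y by auto
  moreover have "poly (P * Q) t = 0" for t using P Q assms(3)[OF aff] by simp
  then have "P * Q = 0" by (intro poly_cofinite_zero)
  ultimately show False by simp
qed

section \<open>The Zariski topology on a set of points\<close>

lemma istopology_zar:
  "istopology (\<lambda>U. \<exists>P. (\<forall>p\<in>P. polyfn p) \<and> U = A - {x. \<forall>p\<in>P. p x = 0})"
  unfolding istopology_def
proof (intro conjI allI impI)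
  fix S T
  assume "\<exists>P. (\<forall>p\<in>P. polyfn p) \<and> S = A - {x. \<forall>p\<in>P. p x = 0}"
    and "\<exists>P. (\<forall>p\<in>P. polyfn p) \<and> T = A - {x. \<forall>p\<in>P. p x = 0}"
  then obtain P Q where PQ: "\<forall>p\<in>P. polyfn p" "S = A - {x. \<forall>p\<in>P. p x = 0}"
    "\<forall>p\<in>Q. polyfn p" "T = A - {x. \<forall>p\<in>Q. p x = 0}" by blast
  \<comment> \<open>Some product is nonzero at x exactly when some member of P and some member of Q
    are.\<close>
  let ?R = "(\<lambda>(p,q) x. p x * q x) ` (P \<times> Q)"
  show "\<exists>P. (\<forall>p\<in>P. polyfn p) \<and> S \<inter> T = A - {x. \<forall>p\<in>P. p x = 0}"
  proof (intro exI[of _ ?R] conjI)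
    show "\<forall>p\<in>?R. polyfn p" using PQ pmult by auto
    show "S \<inter> T = A - {x. \<forall>p\<in>?R. p x = 0}" using PQ by fastforce
  qed
next
  fix K
  assume "\<forall>U\<in>K. \<exists>P. (\<forall>p\<in>P. polyfn p) \<and> U = A - {x. \<forall>p\<in>P. p x = 0}"
  from bchoice[OF this] obtain P
    where P: "\<forall>U\<in>K. (\<forall>p\<in>P U. polyfn p) \<and> U = A - {x. \<forall>p\<in>P U. p x = 0}" ..
  have "\<Union> K = (\<Union>U\<in>K. A - {x. \<forall>p\<in>P U. p x = 0})"
    using P by simp
  also have "\<dots> = A - {x. \<forall>p\<in>(\<Union>U\<in>K. P U). p x = 0}" by blast
  finally show "\<exists>P. (\<forall>p\<in>P. polyfn p) \<and> \<Union> K = A - {x. \<forall>p\<in>P. p x = 0}"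
    using P by (intro exI[of _ "\<Union>U\<in>K. P U"] conjI) blast+
qed

lemma openin_zar: "openin (zar A) U \<longleftrightarrow> (\<exists>P. (\<forall>p\<in>P. polyfn p) \<and> U = A - {x. \<forall>p\<in>P. p x = 0})"
  unfolding zar_def topology_inverse'[OF istopology_zar] ..

lemma openin_zar_self: "openin (zar A) A"
  unfolding openin_zar by (rule exI[of _ "{\<lambda>x. 1}"]) (simp add: pconst)

lemma regular_onI:
  assumes "polyfn p" "polyfn q" "\<And>z. z \<in> Y \<Longrightarrow> q z \<noteq> 0 \<and> h z = p z / q z"
  shows "regular_on Y h"
  unfolding regular_on_def
  by (rule ballI, rule exI[of _ UNIV], rule exI[of _ p], rule exI[of _ q])
    (use assms openin_zar_self[of UNIV] in simp)

section \<open>Irreducible sets and components in general topology\<close>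

lemma irreducible_subtopology:
  assumes "irreducible_in X S" "S \<subseteq> Y"
  shows "irreducible_in (subtopology X Y) S"
  unfolding irreducible_in_def
proof (intro conjI allI impI)
  show "S \<subseteq> topspace (subtopology X Y)" "S \<noteq> {}"
    using assms by (auto simp: irreducible_in_def)
  fix C1 C2
  assume C: "closedin (subtopology X Y) C1 \<and> closedin (subtopology X Y) C2 \<and> S \<subseteq> C1 \<union> C2"
  then obtain D1 D2 where D: "closedin X D1" "closedin X D2" "C1 = D1 \<inter> Y" "C2 = D2 \<inter> Y"
    unfolding closedin_subtopology by blast
  then have "S \<subseteq> D1 \<union> D2" using C by blast
  then have "S \<subseteq> D1 \<or> S \<subseteq> D2"
    using assms(1) D(1,2) unfolding irreducible_in_def by blast
  then show "S \<subseteq> C1 \<or> S \<subseteq> C2" using D assms(2) by blast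
qed

lemma irreducible_closure:
  assumes "irreducible_in X S"
  shows "irreducible_in X (X closure_of S)"
  unfolding irreducible_in_def
proof (intro conjI allI impI)
  have S: "S \<subseteq> topspace X" "S \<noteq> {}" using assms by (auto simp: irreducible_in_def)
  then show "X closure_of S \<subseteq> topspace X" "X closure_of S \<noteq> {}"
    using closure_of_subset_topspace[of X S] closure_of_subset[OF S(1)] by auto
  fix C1 C2
  assume C: "closedin X C1 \<and> closedin X C2 \<and> X closure_of S \<subseteq> C1 \<union> C2"
  then have "S \<subseteq> C1 \<union> C2" using closure_of_subset[OF S(1)] by blast
  then have "S \<subseteq> C1 \<or> S \<subseteq> C2" using assms C unfolding irreducible_in_def by blast
  then show "X closure_of S \<subseteq> C1 \<or> X closure_of S \<subseteq> C2"
    using C closure_of_minimal by metis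
qed

lemma irreducible_finite_cover:
  assumes "irreducible_in X S" "finite K" "\<And>w. w \<in> K \<Longrightarrow> closedin X (C w)" "S \<subseteq> (\<Union>w\<in>K. C w)"
  shows "\<exists>w\<in>K. S \<subseteq> C w"
  using assms(2-4)
proof (induction K rule: finite_induct)
  case empty
  then show ?case using assms(1) by (auto simp: irreducible_in_def)
next
  case (insert w K)
  have "closedin X (\<Union>w\<in>K. C w)" using insert by (intro closedin_Union) auto
  moreover have "S \<subseteq> C w \<union> (\<Union>w\<in>K. C w)" using insert by auto
  ultimately have "S \<subseteq> C w \<or> S \<subseteq> (\<Union>w\<in>K. C w)"
    using assms(1) insert.prems(1)[of w] unfolding irreducible_in_def by blast
  then show ?case using insert by blast
qed

text \<open>An irreducible set inside a finite union of closed sets lies in one of them. So every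
  irreducible set lies in some closure of an S w, and the maximal closures are the components.
  Reflexivity and transitivity of \<open>rel\<close> are inherited from inclusion of
  closures.\<close>

lemma components_of_irreducible_cover:
  assumes fin: "finite W" and irr: "\<And>w. w \<in> W \<Longrightarrow> irreducible_in X (S w)"
    and cover: "topspace X = (\<Union>w\<in>W. S w)"
    and closure_rel: "\<And>w w'. w \<in> W \<Longrightarrow> w' \<in> W \<Longrightarrow> S w \<subseteq> X closure_of S w' \<longleftrightarrow> rel w w'"
    and antisym: "\<And>w w'. w \<in> W \<Longrightarrow> w' \<in> W \<Longrightarrow> rel w w' \<Longrightarrow> rel w' w \<Longrightarrow> w = w'"
  shows "bij_betw (\<lambda>w. X closure_of S w) {w \<in> W. \<forall>w'\<in>W. rel w w' \<longrightarrow> rel w' w} (irreducible_components X)"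
proof -
  let ?C = "\<lambda>w. X closure_of S w"
  let ?M = "{w \<in> W. \<forall>w'\<in>W. rel w w' \<longrightarrow> rel w' w}"
  have S: "S w \<subseteq> topspace X" if "w \<in> W" for w using cover that by blast
  have Cle: "?C w \<subseteq> ?C w' \<longleftrightarrow> rel w w'" if "w \<in> W" "w' \<in> W" for w w'
    using closure_rel[OF that] closure_of_subset[OF S[OF that(1)]]
      closure_of_minimal[OF _ closedin_closure_of[of X "S w'"], of "S w"] by blast
  have small: "\<exists>w\<in>W. T \<subseteq> ?C w" if "irreducible_in X T" for T
  proof (rule irreducible_finite_cover[OF that fin])
    have "T \<subseteq> (\<Union>w\<in>W. S w)" using that cover by (auto simp: irreducible_in_def)
    also have "\<dots> \<subseteq> (\<Union>w\<in>W. ?C w)" using closure_of_subset[OF S] by blast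
    finally show "T \<subseteq> (\<Union>w\<in>W. ?C w)" .
  qed simp
  have trans: "rel u w" if "u \<in> W" "v \<in> W" "w \<in> W" "rel u v" "rel v w" for u v w
    using that Cle[of u v] Cle[of v w] Cle[of u w] by blast
  have above: "\<exists>w'\<in>?M. rel w w'" if "w \<in> W" for w
  proof -
    let ?V = "{v \<in> W. rel w v}"
    have "finite ?V" "w \<in> ?V" using fin that Cle[OF that that] by auto
    \<comment> \<open>Size of the down-set of v. If v maximizes it among the elements above w, then
      any u above v has the same down-set as v, hence lies below v.\<close>
    define h where "h v = card {x \<in> W. rel x v}" for v
    have "Max (h ` ?V) \<in> h ` ?V"
      using \<open>finite ?V\<close> \<open>w \<in> ?V\<close> by (intro Max_in finite_imageI) blast+
    then obtain v where hv: "Max (h ` ?V) = h v" and v: "v \<in> ?V" by (rule imageE)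
    have max: "h u \<le> h v" if "u \<in> ?V" for u
      unfolding hv[symmetric] using \<open>finite ?V\<close> that by (intro Max_ge finite_imageI imageI)
    have "rel u v" if u: "u \<in> W" "rel v u" for u
    proof -
      have vW: "v \<in> W" "rel w v" using v by auto
      have "u \<in> ?V" using trans[OF \<open>w \<in> W\<close> vW(1) u(1) vW(2) u(2)] u by auto
      moreover have "{x \<in> W. rel x v} \<subseteq> {x \<in> W. rel x u}"
        using trans[OF _ vW(1) u(1) _ u(2)] by blast
      ultimately have "{x \<in> W. rel x v} = {x \<in> W. rel x u}"
        using max[of u] fin unfolding h_def by (intro card_seteq) auto
      moreover have "u \<in> {x \<in> W. rel x u}" using u Cle[of u u] by auto
      ultimately show ?thesis by blast
    qed
    then show ?thesis using v by blast
  qed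
  show ?thesis
    unfolding bij_betw_def
  proof
    show "inj_on ?C ?M"
    proof (rule inj_onI)
      fix w w' assume w: "w \<in> ?M" "w' \<in> ?M" "?C w = ?C w'"
      then have W: "w \<in> W" "w' \<in> W" by auto
      have "rel w w'" using Cle[OF W] w(3) by blast
      moreover have "rel w' w" using Cle[OF W(2,1)] w(3) by blast
      ultimately show "w = w'" using antisym W by blast
    qed
    show "?C ` ?M = irreducible_components X"
    proof
      show "?C ` ?M \<subseteq> irreducible_components X"
      proof clarify
        fix w assume w: "w \<in> W" "\<forall>w'\<in>W. rel w w' \<longrightarrow> rel w' w"
        have "T = ?C w" if T: "irreducible_in X T" "?C w \<subseteq> T" for T
        proof -
          obtain w' where w': "w' \<in> W" "T \<subseteq> ?C w'" using small T by blast
          then have "rel w w'" using Cle[OF w(1) w'(1)] T by blast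
          then have "w = w'" using w w'(1) antisym by blast
          then show ?thesis using T w' by blast
        qed
        then show "?C w \<in> irreducible_components X"
          unfolding irreducible_components_def using irreducible_closure[OF irr[OF w(1)]] by blast
      qed
      show "irreducible_components X \<subseteq> ?C ` ?M"
      proof
        fix T assume T: "T \<in> irreducible_components X"
        then obtain w where w: "w \<in> W" "T \<subseteq> ?C w"
          using small unfolding irreducible_components_def by blast
        obtain w' where w': "w' \<in> ?M" "rel w w'" using above[OF w(1)] by blast
        have "T \<subseteq> ?C w'" using w w' Cle[of w w'] by blast
        moreover have "irreducible_in X (?C w')" using irreducible_closure irr w'(1) by blast
        ultimately have "?C w' = T" using T unfolding irreducible_components_def by blast
        then show "T \<in> ?C ` ?M" using w' by blast
      qed
    qed
  qed
qed

section \<open>The quotient topology on the flag variety\<close>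

context flag_type
begin

lemma istopology_fl:
  "istopology (\<lambda>U. U \<subseteq> Fl N n f \<and> openin (zar (GL N)) (GL N \<inter> frame N n f -` U))"
  unfolding istopology_def
proof (intro conjI allI impI)
  fix S T
  assume "S \<subseteq> Fl N n f \<and> openin (zar (GL N)) (GL N \<inter> frame N n f -` S)"
    "T \<subseteq> Fl N n f \<and> openin (zar (GL N)) (GL N \<inter> frame N n f -` T)"
  then show "S \<inter> T \<subseteq> Fl N n f" "openin (zar (GL N)) (GL N \<inter> frame N n f -` (S \<inter> T))"
    using openin_Int[of "zar (GL N)" "GL N \<inter> frame N n f -` S" "GL N \<inter> frame N n f -` T"]
    by (auto simp: Int_ac)
next
  fix K
  assume K: "\<forall>S\<in>K. S \<subseteq> Fl N n f \<and> openin (zar (GL N)) (GL N \<inter> frame N n f -` S)"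
  then show "\<Union> K \<subseteq> Fl N n f" by blast
  have "GL N \<inter> frame N n f -` (\<Union> K) = \<Union> ((\<lambda>S. GL N \<inter> frame N n f -` S) ` K)" by blast
  moreover have "openin (zar (GL N)) (\<Union> ((\<lambda>S. GL N \<inter> frame N n f -` S) ` K))"
    using K by (intro openin_Union) blast
  ultimately show "openin (zar (GL N)) (GL N \<inter> frame N n f -` (\<Union> K))" by metis
qed

lemma openin_fl: "openin (fl_top N n f) U \<longleftrightarrow>
    U \<subseteq> Fl N n f \<and> openin (zar (GL N)) (GL N \<inter> frame N n f -` U)"
  unfolding fl_top_def topology_inverse'[OF istopology_fl] ..

lemma topspace_fl: "topspace (fl_top N n f) = Fl N n f"
proof -
  have "GL N \<inter> frame N n f -` Fl N n f = GL N" using frame_Fl by blast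
  then have "openin (fl_top N n f) (Fl N n f)" by (simp add: openin_fl openin_zar_self)
  then show ?thesis
    using openin_subset openin_fl openin_topspace by (metis subset_antisym)
qed

text \<open>The working form of closedness: equations on frames. By \<open>frame_Fl\<close>,
  complements in \<open>Fl N n f\<close> pull back to complements in \<open>GL N\<close>.\<close>

lemma closedin_fl: "closedin (fl_top N n f) C \<longleftrightarrow> C \<subseteq> Fl N n f \<and>
    (\<exists>P. (\<forall>p\<in>P. polyfn p) \<and> (\<forall>g\<in>GL N. frame N n f g \<in> C \<longleftrightarrow> (\<forall>p\<in>P. p g = 0)))"
proof -
  have vanish: "GL N \<inter> frame N n f -` (Fl N n f - C) = GL N - {g. \<forall>p\<in>P. p g = 0} \<longleftrightarrow>
      (\<forall>g\<in>GL N. frame N n f g \<in> C \<longleftrightarrow> (\<forall>p\<in>P. p g = 0))" for P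
  proof -
    have "GL N \<inter> frame N n f -` (Fl N n f - C) = {g \<in> GL N. frame N n f g \<notin> C}"
      using frame_Fl by auto
    then show ?thesis by (simp only:) blast
  qed
  show ?thesis
    unfolding closedin_def topspace_fl openin_fl openin_zar vanish by simp
qed

text \<open>If the image left both closed sets, one equation of each, pulled back along \<phi>,
  would be nonzero somewhere on the affine space, although their product vanishes there; this
  contradicts \<open>aff_prime\<close>.\<close>

lemma irreducible_param:
  assumes poly: "\<And>ij. polyfn (\<lambda>z. \<phi> z ij)" and GL: "\<And>z. z \<in> aff d \<Longrightarrow> \<phi> z \<in> GL N"
  shows "irreducible_in (fl_top N n f) ((\<lambda>z. frame N n f (\<phi> z)) ` aff d)"
  unfolding irreducible_in_def
proof (intro conjI allI impI)
  let ?S = "(\<lambda>z. frame N n f (\<phi> z)) ` aff d"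
  show "?S \<subseteq> topspace (fl_top N n f)" using GL frame_Fl by (auto simp: topspace_fl)
  have "0 \<in> aff d" by (simp add: aff_def)
  then show "?S \<noteq> {}" by blast
  fix C1 C2
  assume C: "closedin (fl_top N n f) C1 \<and> closedin (fl_top N n f) C2 \<and> ?S \<subseteq> C1 \<union> C2"
  have c1: "closedin (fl_top N n f) C1" and c2: "closedin (fl_top N n f) C2" using C by auto
  obtain P1 where P1: "\<forall>p\<in>P1. polyfn p" "\<And>g. g \<in> GL N \<Longrightarrow> frame N n f g \<in> C1 \<longleftrightarrow> (\<forall>p\<in>P1. p g = 0)"
    using c1[unfolded closedin_fl] by (elim conjE exE) simp
  obtain P2 where P2: "\<forall>p\<in>P2. polyfn p" "\<And>g. g \<in> GL N \<Longrightarrow> frame N n f g \<in> C2 \<longleftrightarrow> (\<forall>p\<in>P2. p g = 0)"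
    using c2[unfolded closedin_fl] by (elim conjE exE) simp
  show "?S \<subseteq> C1 \<or> ?S \<subseteq> C2"
  proof (rule ccontr)
    assume "\<not> ?thesis"
    then obtain z1 z2 where z: "z1 \<in> aff d" "frame N n f (\<phi> z1) \<notin> C1" "z2 \<in> aff d" "frame N n f (\<phi> z2) \<notin> C2"
      by blast
    then obtain p q where pq: "p \<in> P1" "p (\<phi> z1) \<noteq> 0" "q \<in> P2" "q (\<phi> z2) \<noteq> 0"
      using P1(2)[OF GL] P2(2)[OF GL] by blast
    have "polyfn p" "polyfn q" using pq P1(1) P2(1) by blast+
    then have "polyfn (\<lambda>z. p (\<phi> z))" "polyfn (\<lambda>z. q (\<phi> z))"
      using polyfn_subst[where \<phi> = \<phi>, OF _ poly] by auto
    moreover have "p (\<phi> z) * q (\<phi> z) = 0" if "z \<in> aff d" for z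
    proof -
      have "frame N n f (\<phi> z) \<in> C1 \<union> C2" using C that by blast
      then show ?thesis using P1(2)[OF GL[OF that]] P2(2)[OF GL[OF that]] pq by auto
    qed
    ultimately show False using aff_prime[of "\<lambda>z. p (\<phi> z)" "\<lambda>z. q (\<phi> z)" d] pq z by blast
  qed
qed

end

section \<open>The tableau order\<close>

lemma card_Int_atMost_sorted:
  fixes A :: "nat set"
  assumes "finite A"
  shows "card (A \<inter> {..k}) = card {i. i < card A \<and> sorted_list_of_set A ! i \<le> k}"
proof -
  let ?xs = "sorted_list_of_set A"
  have len: "length ?xs = card A" by simp
  have "A \<inter> {..k} = (!) ?xs ` {i. i < card A \<and> ?xs ! i \<le> k}"
  proof
    show "A \<inter> {..k} \<subseteq> (!) ?xs ` {i. i < card A \<and> ?xs ! i \<le> k}"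
    proof
      fix x assume x: "x \<in> A \<inter> {..k}"
      then have "x \<in> set ?xs" using assms by simp
      then obtain i where "i < length ?xs" "?xs ! i = x" by (auto simp: in_set_conv_nth)
      then show "x \<in> (!) ?xs ` {i. i < card A \<and> ?xs ! i \<le> k}" using x len by auto
    qed
    show "(!) ?xs ` {i. i < card A \<and> ?xs ! i \<le> k} \<subseteq> A \<inter> {..k}"
    proof
      fix x assume "x \<in> (!) ?xs ` {i. i < card A \<and> ?xs ! i \<le> k}"
      then obtain i where i: "i < card A" "?xs ! i \<le> k" "x = ?xs ! i" by auto
      then have "x \<in> set ?xs" using len by auto
      then show "x \<in> A \<inter> {..k}" using i assms by auto
    qed
  qed
  moreover have "inj_on ((!) ?xs) {i. i < card A \<and> ?xs ! i \<le> k}"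
    by (rule inj_on_subset[OF inj_on_nth[of ?xs "{..<card A}"]]) auto
  ultimately show ?thesis by (simp add: card_image)
qed

text \<open>The i-th smallest element is at most k exactly when at least i elements are. The
  counting form is the one that dimension arguments and exchanges of letters can handle.\<close>

lemma list_all2_sorted_iff_card:
  fixes A B :: "nat set"
  assumes fin: "finite A" "finite B" and card: "card A = card B"
  shows "list_all2 (\<le>) (sorted_list_of_set A) (sorted_list_of_set B) \<longleftrightarrow>
    (\<forall>k. card (B \<inter> {..k}) \<le> card (A \<inter> {..k}))"
proof
  let ?xs = "sorted_list_of_set A" and ?ys = "sorted_list_of_set B"
  assume "list_all2 (\<le>) ?xs ?ys"
  then have le: "?xs ! i \<le> ?ys ! i" if "i < card A" for i
    using that by (auto simp: list_all2_conv_all_nth)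
  show "\<forall>k. card (B \<inter> {..k}) \<le> card (A \<inter> {..k})"
  proof
    fix k
    have "{i. i < card B \<and> ?ys ! i \<le> k} \<subseteq> {i. i < card A \<and> ?xs ! i \<le> k}"
      using le card by (auto intro: order_trans)
    then show "card (B \<inter> {..k}) \<le> card (A \<inter> {..k})"
      unfolding card_Int_atMost_sorted[OF fin(1)] card_Int_atMost_sorted[OF fin(2)]
      by (intro card_mono) auto
  qed
next
  let ?xs = "sorted_list_of_set A" and ?ys = "sorted_list_of_set B"
  assume le: "\<forall>k. card (B \<inter> {..k}) \<le> card (A \<inter> {..k})"
  have "?xs ! i \<le> ?ys ! i" if i: "i < card A" for i
  proof (rule ccontr)
    assume "\<not> ?xs ! i \<le> ?ys ! i"
    then have less: "?ys ! i < ?xs ! i" by simp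
    \<comment> \<open>For the bound \<open>?ys ! i\<close>, the set B has at least i + 1 elements up
      to it, but A at most i.\<close>
    have "{..i} \<subseteq> {j. j < card B \<and> ?ys ! j \<le> ?ys ! i}"
      using i card by (auto intro!: sorted_nth_mono)
    then have "card {..i} \<le> card (B \<inter> {..?ys ! i})"
      unfolding card_Int_atMost_sorted[OF fin(2)] by (intro card_mono) auto
    moreover have "{j. j < card A \<and> ?xs ! j \<le> ?ys ! i} \<subseteq> {..<i}"
    proof
      fix j assume j: "j \<in> {j. j < card A \<and> ?xs ! j \<le> ?ys ! i}"
      show "j \<in> {..<i}"
      proof (rule ccontr)
        assume "j \<notin> {..<i}"
        then have "?xs ! i \<le> ?xs ! j" using j by (intro sorted_nth_mono) auto
        then show False using j less by simp
      qed
    qed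
    then have "card (A \<inter> {..?ys ! i}) \<le> card {..<i}"
      unfolding card_Int_atMost_sorted[OF fin(1)] by (intro card_mono) auto
    moreover have "card (B \<inter> {..?ys ! i}) \<le> card (A \<inter> {..?ys ! i})" using le by blast
    ultimately show False by simp
  qed
  then show "list_all2 (\<le>) ?xs ?ys" using card by (auto simp: list_all2_conv_all_nth)
qed

text \<open>Rank function of the word A. For the word of an increasing family I of subsets of {1..N}
  and a in {1..n} it is the number of elements of I a up to x. As a sum of \<open>of_bool\<close> it
  can be reindexed along a transposition.\<close>

definition rk :: "(nat \<Rightarrow> nat) \<Rightarrow> nat \<Rightarrow> nat \<Rightarrow> nat" where
  "rk A a x = (\<Sum>y\<in>{1..x}. of_bool (A y \<le> a))"

lemma rk_card: "rk A a x = card {y \<in> {1..x}. A y \<le> a}"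
  unfolding rk_def by (simp add: Int_def sum_of_bool_eq)

lemma rk_swap_above:
  assumes "1 \<le> k" "k < k'" "k' \<le> x"
  shows "rk (A \<circ> transpose k k') a x = rk A a x"
proof -
  have "transpose k k' permutes {1..x}" using assms by (intro permutes_swap_id) auto
  then show ?thesis
    unfolding rk_def using sum.permute[of "transpose k k'" "{1..x}" "\<lambda>y. of_bool (A y \<le> a) :: nat"]
    by (simp add: comp_def del: sum_of_bool_eq)
qed

lemma rk_swap_below:
  assumes "k < k'" "x < k"
  shows "rk (A \<circ> transpose k k') a x = rk A a x"
  unfolding rk_def by (rule sum.cong) (use assms in \<open>auto simp: transpose_def\<close>)

text \<open>Of the two exchanged positions only k lies in {1..x}. The terms stand on both sides as
  additions because subtraction of natural numbers truncates.\<close>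

lemma rk_swap_between:
  assumes "1 \<le> k" "k \<le> x" "x < k'"
  shows "rk (A \<circ> transpose k k') a x + of_bool (A k \<le> a) = rk A a x + of_bool (A k' \<le> a)"
proof -
  have k: "k \<in> {1..x}" using assms by auto
  have "(\<Sum>y\<in>{1..x} - {k}. of_bool ((A \<circ> transpose k k') y \<le> a))
      = (\<Sum>y\<in>{1..x} - {k}. of_bool (A y \<le> a) :: nat)"
    by (rule sum.cong) (use assms in \<open>auto simp: transpose_def\<close>)
  then show ?thesis
    unfolding rk_def using sum.remove[OF _ k, of "\<lambda>y. of_bool (A y \<le> a) :: nat"]
      sum.remove[OF _ k, of "\<lambda>y. of_bool ((A \<circ> transpose k k') y \<le> a) :: nat"] by simp
qed

lemma rk_split:
  assumes "a \<le> t"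
  shows "rk A t x = rk A a x + (\<Sum>y\<in>{1..x}. of_bool (a < A y \<and> A y \<le> t))"
  unfolding rk_def sum.distrib[symmetric] by (rule sum.cong) (use assms in auto)

text \<open>The difference is the product of k' - k and A k' - A k. The weighted sum is the measure
  for the induction over exchanges.\<close>

lemma weight_swap:
  fixes A :: "nat \<Rightarrow> nat"
  assumes "1 \<le> k" "k < k'" "k' \<le> N" "A k < A k'"
  shows "(\<Sum>y\<in>{1..N}. y * (A \<circ> transpose k k') y) < (\<Sum>y\<in>{1..N}. y * A y)"
proof -
  have split: "(\<Sum>y\<in>{1..N}. y * C y) = k * C k + (k' * C k' + (\<Sum>y\<in>{1..N} - {k} - {k'}. y * C y))"
    for C :: "nat \<Rightarrow> nat"
    using assms by (simp add: sum.remove[of _ k] sum.remove[of _ k'])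
  have "(\<Sum>y\<in>{1..N} - {k} - {k'}. y * (A \<circ> transpose k k') y) = (\<Sum>y\<in>{1..N} - {k} - {k'}. y * A y)"
    by (rule sum.cong) (auto simp: transpose_def)
  moreover obtain d e where "k' = k + Suc d" "A k' = A k + Suc e"
    using assms by (metis add_Suc_right less_imp_Suc_add)
  ultimately show ?thesis
    unfolding split[of A] split[of "A \<circ> transpose k k'"] by (simp add: algebra_simps)
qed

text \<open>At the first position where A and B differ, A has the smaller letter s and B the larger
  letter t; exchanging s with the nearest later letter of A in the interval from s + 1 to t stays below B.\<close>
lemma bruhat_step:
  assumes le: "\<And>a x. x \<le> N \<Longrightarrow> rk B a x \<le> rk A a x"
    and content: "\<And>a. rk A a N = rk B a N"
    and neq: "\<exists>k\<in>{1..N}. A k \<noteq> B k"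
  obtains k k' where "1 \<le> k" "k < k'" "k' \<le> N" "A k < A k'"
    "\<And>a x. x \<le> N \<Longrightarrow> rk B a x \<le> rk (A \<circ> transpose k k') a x"
proof -
  define k where "k = (LEAST k. k \<in> {1..N} \<and> A k \<noteq> B k)"
  have k: "k \<in> {1..N}" "A k \<noteq> B k"
    using LeastI_ex[of "\<lambda>k. k \<in> {1..N} \<and> A k \<noteq> B k"] neq unfolding k_def by blast+
  have agree: "A y = B y" if "y \<in> {1..<k}" for y
    using not_less_Least[of y "\<lambda>k. k \<in> {1..N} \<and> A k \<noteq> B k"] that k(1) unfolding k_def[symmetric] by auto
  have sumk: "(\<Sum>y\<in>{1..k}. h y) = (\<Sum>y\<in>{1..<k}. h y) + h k" for h :: "nat \<Rightarrow> nat"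
    using k(1) by (simp add: sum.last_plus add.commute)
  \<comment> \<open>Compare the ranks at letter B k and length k: before k the words agree, so only
    position k decides.\<close>
  have "A k \<le> B k"
  proof -
    have "(\<Sum>y\<in>{1..<k}. of_bool (A y \<le> B k)) = (\<Sum>y\<in>{1..<k}. of_bool (B y \<le> B k) :: nat)"
      by (rule sum.cong) (auto simp: agree)
    then have "of_bool (B k \<le> B k) \<le> (of_bool (A k \<le> B k) :: nat)"
      using le[of k "B k"] k(1) unfolding rk_def sumk by (simp del: sum_of_bool_eq)
    then show ?thesis by (cases "A k \<le> B k") auto
  qed
  then have lt: "A k < B k" using k by simp
  \<comment> \<open>Count letters in the interval from a + 1 to B k among the first x positions: the
    words agree before k, at k only B has such a letter, and A gets none afterwards. As A has at
    least as many letters up to B k, it must have strictly more letters up to a.\<close>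
  have claim: "rk B a x < rk A a x"
    if x: "k \<le> x" "x \<le> N" and a: "A k \<le> a" "a < B k"
      and none: "\<And>y. k < y \<Longrightarrow> y \<le> x \<Longrightarrow> \<not> (A k < A y \<and> A y \<le> B k)" for a x
  proof -
    define cnt where "cnt C y = (of_bool (a < C y \<and> C y \<le> B k) :: nat)" for C :: "nat \<Rightarrow> nat" and y
    have split: "{1..x} = {1..k} \<union> {k<..x}" using x k(1) by auto
    have sumx: "(\<Sum>y\<in>{1..x}. cnt C y) = (\<Sum>y\<in>{1..<k}. cnt C y) + cnt C k + (\<Sum>y\<in>{k<..x}. cnt C y)" for C
      unfolding split sumk[symmetric] by (rule sum.union_disjoint) auto
    have "(\<Sum>y\<in>{k<..x}. cnt A y) = 0"
      using none a(1) by (intro sum.neutral) (auto simp: cnt_def)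
    moreover have "cnt A k = 0" "cnt B k = 1" using a by (auto simp: cnt_def)
    moreover have "(\<Sum>y\<in>{1..<k}. cnt A y) = (\<Sum>y\<in>{1..<k}. cnt B y)"
      by (rule sum.cong) (auto simp: agree cnt_def)
    ultimately have "(\<Sum>y\<in>{1..x}. cnt A y) < (\<Sum>y\<in>{1..x}. cnt B y)" unfolding sumx by simp
    moreover have "rk B (B k) x \<le> rk A (B k) x" using le x by blast
    ultimately show ?thesis
      using rk_split[of a "B k" A x] rk_split[of a "B k" B x] a by (simp add: cnt_def)
  qed
  \<comment> \<open>Otherwise the strict inequality would extend to x = N, where the contents
    agree.\<close>
  have "\<exists>y. k < y \<and> y \<le> N \<and> A k < A y \<and> A y \<le> B k"
  proof (rule ccontr)
    assume "\<not> ?thesis"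
    then have "rk B (A k) N < rk A (A k) N" using k lt by (intro claim) auto
    then show False using content by simp
  qed
  then obtain k' where k': "k < k'" "k' \<le> N" "A k < A k'" "A k' \<le> B k"
    and least: "\<And>y. y < k' \<Longrightarrow> \<not> (k < y \<and> y \<le> N \<and> A k < A y \<and> A y \<le> B k)"
    using exists_least_iff[of "\<lambda>y. k < y \<and> y \<le> N \<and> A k < A y \<and> A y \<le> B k"] by blast
  have "rk B a x \<le> rk (A \<circ> transpose k k') a x" if x: "x \<le> N" for a x
  proof (cases "k \<le> x \<and> x < k'")
    case True
    have "rk (A \<circ> transpose k k') a x + of_bool (A k \<le> a) = rk A a x + of_bool (A k' \<le> a)"
      using True k(1) by (intro rk_swap_between) auto
    moreover have "rk B a x < rk A a x" if "A k \<le> a" "a < A k'"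
      using True that k'(4) x least by (intro claim) auto
    ultimately show ?thesis using le[OF x, of a] by (cases "A k \<le> a"; cases "a < A k'") auto
  next
    case False
    then have "rk (A \<circ> transpose k k') a x = rk A a x"
      using rk_swap_above[of k k' x A a] rk_swap_below[of k k' x A a] k(1) k'(1) by auto
    then show ?thesis using le[OF x] by simp
  qed
  then show thesis using that[of k k'] k(1) k' by auto
qed

text \<open>Each exchange keeps the content, since both positions lie in {1..N}, and stays below B
  by \<open>bruhat_step\<close>, so finitely many exchanges lead from A to B. The property Q travels
  along this chain in the opposite direction, from B to A.\<close>

lemma bruhat_induct:
  assumes "\<And>a x. x \<le> N \<Longrightarrow> rk B a x \<le> rk A a x" "\<And>a. rk A a N = rk B a N"
    and base: "\<And>A. (\<And>y. y \<in> {1..N} \<Longrightarrow> A y = B y) \<Longrightarrow> Q A"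
    and step: "\<And>A k k'. (\<And>a. rk A a N = rk B a N) \<Longrightarrow> 1 \<le> k \<Longrightarrow> k < k' \<Longrightarrow> k' \<le> N \<Longrightarrow>
      A k < A k' \<Longrightarrow> Q (A \<circ> transpose k k') \<Longrightarrow> Q A"
  shows "Q A"
  using assms(1,2)
proof (induction "\<Sum>y\<in>{1..N}. y * A y" arbitrary: A rule: less_induct)
  case less
  show ?case
  proof (cases "\<exists>k\<in>{1..N}. A k \<noteq> B k")
    case True
    obtain k k' where k: "1 \<le> k" "k < k'" "k' \<le> N" "A k < A k'"
      and le: "\<And>a x. x \<le> N \<Longrightarrow> rk B a x \<le> rk (A \<circ> transpose k k') a x"
      using bruhat_step[OF less.prems True] by blast
    have "Q (A \<circ> transpose k k')"
      using less.hyps[OF weight_swap[where A = A, OF k] le] rk_swap_above[OF k(1-3)] less.prems(2)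
      by simp
    then show ?thesis using step[OF less.prems(2) k] by blast
  next
    case False
    then show ?thesis using base by blast
  qed
qed

section \<open>Minors and Schubert varieties\<close>

text \<open>A nonzero difference would have its lead in \<open>leads U\<close>, where it vanishes.
  This gives uniqueness of reduced echelon vectors.\<close>

lemma eq_on_leads:
  assumes U: "vsubspace U" "U \<subseteq> coord {1..N}" and y: "y \<in> U" "y' \<in> U"
    and eq: "\<And>j. j \<in> leads U \<Longrightarrow> y j = y' j"
  shows "y = y'"
proof (rule ccontr)
  assume "y \<noteq> y'"
  then have ne: "y - y' \<noteq> 0" by simp
  have mem: "y - y' \<in> U" using V.subspace_diff[OF U(1) y] .
  then have "y - y' \<in> coord {1..N}" using U(2) by blast
  then obtain k where k: "lead_at (y - y') k" using exists_lead[OF ne] by blast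
  then have "k \<in> leads U" using mem by (auto simp: leads_def)
  then show False using k eq by (simp add: lead_at_def)
qed

lemma colspan_apply: "(\<Sum>j\<in>{1..F}. sc (c j) (colv g j)) i = (\<Sum>j\<in>{1..F}. g (i,j) * c j)"
  by (simp add: sum_fun_app sc_apply colv_def mult.commute)

text \<open>A singular minor would yield a nonzero vector of the column span that vanishes at all
  leads.\<close>

lemma minor_leads_nonzero:
  assumes g: "g \<in> GL N" and F: "F \<le> N" and \<rho>: "\<rho> ` {0..<F} = leads (vspan (colv g ` {1..F}))"
  shows "det (minor_mat \<rho> F g) \<noteq> 0"
proof
  assume "det (minor_mat \<rho> F g) = 0"
  then obtain c where c: "\<exists>j\<in>{1..F}. c j \<noteq> 0" "\<And>i. i < F \<Longrightarrow> (\<Sum>j\<in>{1..F}. g (\<rho> i, j) * c j) = 0"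
    unfolding minor_zero_iff by blast
  let ?x = "\<Sum>j\<in>{1..F}. sc (c j) (colv g j)"
  have x: "?x \<in> vspan (colv g ` {1..F})"
    by (intro V.span_sum V.span_scale V.span_base imageI)
  have "?x \<noteq> 0" using colspan_GL(2)[OF g F, of c] c(1) by blast
  moreover have "?x \<in> coord {1..N}" using x colspan_GL(1)[OF g F] by blast
  ultimately obtain k where k: "lead_at ?x k" using exists_lead by blast
  then have "k \<in> leads (vspan (colv g ` {1..F}))" using x by (auto simp: leads_def)
  then obtain i where i: "i < F" "k = \<rho> i" using \<rho> by (metis atLeastLessThan_iff imageE)
  then have "?x k = 0" unfolding colspan_apply using c(2) by simp
  then show False using k by (simp add: lead_at_def)
qed

text \<open>A nonzero minor makes the projection of the column span to the rows of \<rho> injective.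
  Vectors with lead at most k project into coordinates at most k, and dimensions are compared. With
  \<open>minor_leads_nonzero\<close>, the leads are the largest row set with nonvanishing
  minor.\<close>

lemma minor_nonzero_leads:
  assumes g: "g \<in> GL N" and F: "F \<le> N" and det: "det (minor_mat \<rho> F g) \<noteq> 0"
  shows "card (leads (vspan (colv g ` {1..F})) \<inter> {..k}) \<le> card (\<rho> ` {0..<F} \<inter> {..k})"
proof -
  let ?U = "vspan (colv g ` {1..F})" and ?J = "\<rho> ` {0..<F}"
  let ?L = "leads ?U \<inter> {..k}"
  obtain x where x: "\<And>l. l \<in> leads ?U \<Longrightarrow> x l \<in> ?U \<and> lead_at (x l) l"
    using lead_family by blast
  define proj :: "vect \<Rightarrow> vect" where "proj y = (\<lambda>i. if i \<in> ?J then y i else 0)" for y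
  have fin: "finite ?L" by simp
  have triv: "\<forall>l\<in>?L. c l = 0" if c: "(\<Sum>l\<in>?L. sc (c l) (proj (x l))) = 0" for c
  proof -
    let ?y = "\<Sum>l\<in>?L. sc (c l) (x l)"
    have y0: "?y i = 0" if "i \<in> ?J" for i
    proof -
      have "?y i = (\<Sum>l\<in>?L. sc (c l) (proj (x l))) i"
        using that by (simp add: sum_fun_app sc_apply proj_def)
      then show ?thesis using c by simp
    qed
    have "?y \<in> ?U" using x by (intro V.span_sum V.span_scale) auto
    then obtain d where d: "?y = (\<Sum>j\<in>{1..F}. sc (d j) (colv g j))"
      unfolding span_family[OF finite_atLeastAtMost] by blast
    have "(\<Sum>j\<in>{1..F}. g (\<rho> i, j) * d j) = 0" if "i < F" for i
      using y0[of "\<rho> i"] that unfolding d colspan_apply by simp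
    then have "\<forall>j\<in>{1..F}. d j = 0" using det unfolding minor_zero_iff by blast
    then have "?y = 0" unfolding d by (intro sum.neutral) simp
    then show ?thesis using lead_family_trivial[OF fin, of x c] x by blast
  qed
  have "proj (x l) \<in> coord (?J \<inter> {..k})" if "l \<in> ?L" for l
    using x[of l] that by (auto simp: proj_def coord_def lead_at_def not_le)
  then have "(\<lambda>l. proj (x l)) ` ?L \<subseteq> vspan (bvec ` (?J \<inter> {..k}))"
    by (subst span_bvec) auto
  then have "card ((\<lambda>l. proj (x l)) ` ?L) \<le> card (bvec ` (?J \<inter> {..k}))"
    using V.independent_span_bound[OF _ independent_family(2)[OF fin triv]] by simp
  also have "\<dots> \<le> card (?J \<inter> {..k})" by (intro card_image_le) simp
  also have "card ((\<lambda>l. proj (x l)) ` ?L) = card ?L"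
    by (intro card_image independent_family(1)[OF fin triv])
  finally show ?thesis .
qed

text \<open>Cramer's rule: the vectors of the reduced echelon basis are quotients of minors.\<close>
lemma echelon_vector:
  assumes L: "finite L" "card L = F" "l \<in> L" and F: "F \<le> N"
  obtains p q where "polyfn q" "\<And>i. polyfn (p i)"
    "\<And>g. g \<in> GL N \<Longrightarrow> leads (vspan (colv g ` {1..F})) = L \<Longrightarrow>
      q g \<noteq> 0 \<and> (\<lambda>i. p i g / q g) \<in> vspan (colv g ` {1..F}) \<and>
      (\<forall>j\<in>L. p j g / q g = (if j = l then 1 else 0))"
proof -
  obtain \<rho> where \<rho>: "bij_betw \<rho> {0..<F} L" using ex_bij_betw_nat_finite[OF L(1)] L(2) by blast
  then have im: "\<rho> ` {0..<F} = L" by (simp add: bij_betw_def)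
  then obtain k where k: "k < F" "\<rho> k = l" using L(3) by (metis atLeastLessThan_iff imageE)
  define q where "q g = det (minor_mat \<rho> F g)" for g
  \<comment> \<open>k is the place of l in the enumeration \<rho>. The columns of g are combined
    with the k-th column of the adjugate as coefficients; on the rows listed by \<rho> this gives q
    times the k-th unit vector.\<close>
  define p where "p i g = (\<Sum>j\<in>{0..<F}. g (i, Suc j) * adj_mat (minor_mat \<rho> F g) $$ (j, k))" for i and g :: matr
  show thesis
  proof
    show "polyfn q" unfolding q_def by (rule polyfn_minor)
    show "polyfn (p i)" for i
      unfolding p_def by (intro polyfn_sum pmult pvar polyfn_adj_minor) (use k in auto)
    fix g assume g: "g \<in> GL N" and Lg: "leads (vspan (colv g ` {1..F})) = L"
    let ?A = "minor_mat \<rho> F g"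
    note adj = adj_mat[OF minor_mat_carrier[of \<rho> F g]]
    have q: "q g \<noteq> 0" unfolding q_def using minor_leads_nonzero[OF g F, of \<rho>] Lg im by simp
    have "(\<lambda>i. p i g / q g) = (\<Sum>j\<in>{1..F}. sc (adj_mat ?A $$ (j - 1, k) / q g) (colv g j))"
    proof
      fix i
      show "p i g / q g = (\<Sum>j\<in>{1..F}. sc (adj_mat ?A $$ (j - 1, k) / q g) (colv g j)) i"
        unfolding colspan_apply unfolding sum_upto_Suc p_def by (simp add: sum_divide_distrib)
    qed
    also have "\<dots> \<in> vspan (colv g ` {1..F})"
      by (intro V.span_sum V.span_scale V.span_base imageI)
    finally have mem: "(\<lambda>i. p i g / q g) \<in> vspan (colv g ` {1..F})" .
    have "p j g / q g = (if j = l then 1 else 0)" if j: "j \<in> L" for j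
    proof -
      obtain i where i: "i < F" "j = \<rho> i" using j unfolding im[symmetric] by auto
      have "p j g = (?A * adj_mat ?A) $$ (i, k)"
        unfolding p_def i using i k adj(1) by (simp add: scalar_prod_def minor_mat_def)
      also have "\<dots> = (if i = k then q g else 0)"
        unfolding adj(2) q_def using i k by simp
      also have "i = k \<longleftrightarrow> j = l"
        using i k \<rho> by (auto simp: bij_betw_def inj_on_def)
      finally show ?thesis using q by simp
    qed
    then show "q g \<noteq> 0 \<and> (\<lambda>i. p i g / q g) \<in> vspan (colv g ` {1..F}) \<and>
        (\<forall>j\<in>L. p j g / q g = (if j = l then 1 else 0))"
      using q mem by blast
  qed
qed

section \<open>Closed conditions on leads, and the word of an increasing family\<close>

context flag_type
begin

text \<open>The inequality is reversed because larger tableau entries mean fewer elements up to each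
  bound.\<close>

definition below :: "(nat \<Rightarrow> nat set) \<Rightarrow> (nat \<Rightarrow> nat set) \<Rightarrow> bool" where
  "below I J \<longleftrightarrow> (\<forall>a\<in>{1..n}. \<forall>k. card (J a \<inter> {..k}) \<le> card (I a \<inter> {..k}))"

definition schubert :: "(nat \<Rightarrow> nat set) \<Rightarrow> flag set" where
  "schubert J = {U \<in> Fl N n f. below (\<lambda>a. leads (U a)) J}"

text \<open>The equations are the minors whose row set has too few elements up to some k. On the set
  they vanish, since a nonzero one would bound the counts of leads by those of its rows. Off the
  set, the minor on the leads themselves is among them and is nonzero.\<close>

lemma closedin_schubert: "closedin (fl_top N n f) (schubert J)"
proof -
  define P where "P = {\<lambda>g. det (minor_mat \<rho> (f a) g) |\<rho> a. a \<in> {1..n} \<and>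
    (\<exists>k. card (\<rho> ` {0..<f a} \<inter> {..k}) < card (J a \<inter> {..k}))}"
  have "frame N n f g \<in> schubert J \<longleftrightarrow> (\<forall>p\<in>P. p g = 0)" if g: "g \<in> GL N" for g
  proof
    assume S: "frame N n f g \<in> schubert J"
    show "\<forall>p\<in>P. p g = 0"
    proof
      fix p assume "p \<in> P"
      then obtain \<rho> a k where p: "p = (\<lambda>g. det (minor_mat \<rho> (f a) g))" "a \<in> {1..n}"
        "card (\<rho> ` {0..<f a} \<inter> {..k}) < card (J a \<inter> {..k})" unfolding P_def by blast
      have "card (J a \<inter> {..k}) \<le> card (leads (vspan (colv g ` {1..f a})) \<inter> {..k})"
        using S p(2) by (auto simp: schubert_def below_def frame_eq)
      then show "p g = 0"
        using minor_nonzero_leads[OF g f_le[OF p(2)], of \<rho> k] p by force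
    qed
  next
    assume z: "\<forall>p\<in>P. p g = 0"
    have "card (J a \<inter> {..k}) \<le> card (leads (vspan (colv g ` {1..f a})) \<inter> {..k})"
      if a: "a \<in> {1..n}" for a k
    proof (rule ccontr)
      assume less: "\<not> ?thesis"
      let ?L = "leads (vspan (colv g ` {1..f a}))"
      have fr: "frame N n f g a = vspan (colv g ` {1..f a})" using a by (simp add: frame_eq)
      have "card ?L = f a" using Fl_D(3)[OF frame_Fl[OF g] a] unfolding fr .
      moreover have "finite ?L"
        using leads_subset[OF colspan_GL(1)[OF g f_le[OF a]]] finite_subset by blast
      ultimately obtain \<rho> where "bij_betw \<rho> {0..<f a} ?L" using ex_bij_betw_nat_finite by metis
      then have im: "\<rho> ` {0..<f a} = ?L" by (simp add: bij_betw_def)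
      have mem: "(\<lambda>g. det (minor_mat \<rho> (f a) g)) \<in> P"
        unfolding P_def mem_Collect_eq
        by (rule exI[of _ \<rho>], rule exI[of _ a]) (use a less im in \<open>auto simp: not_le\<close>)
      from bspec[OF z mem] show False using minor_leads_nonzero[OF g f_le[OF a] im] by simp
    qed
    then show "frame N n f g \<in> schubert J"
      using frame_Fl[OF g] by (auto simp: schubert_def below_def frame_eq)
  qed
  moreover have "\<forall>p\<in>P. polyfn p" unfolding P_def using polyfn_minor by blast
  ultimately show ?thesis unfolding closedin_fl by (auto simp: schubert_def)
qed

text \<open>For an increasing family this is the first a with x in I a. Counting the misses, instead
  of taking a least index, also yields the letter n + 1 when x is in no I a.\<close>

definition level :: "(nat \<Rightarrow> nat set) \<Rightarrow> nat \<Rightarrow> nat" where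
  "level I x = Suc (card {a \<in> {1..n}. x \<notin> I a})"

lemma level_le_iff:
  assumes mono: "\<And>a b. a \<in> {1..n} \<Longrightarrow> b \<in> {1..n} \<Longrightarrow> a \<le> b \<Longrightarrow> I a \<subseteq> I b"
    and a: "a \<in> {1..n}"
  shows "level I x \<le> a \<longleftrightarrow> x \<in> I a"
proof
  assume x: "x \<in> I a"
  have "{a \<in> {1..n}. x \<notin> I a} \<subseteq> {1..<a}"
  proof
    fix b assume b: "b \<in> {a \<in> {1..n}. x \<notin> I a}"
    then have "\<not> a \<le> b" using mono[OF a, of b] x by blast
    then show "b \<in> {1..<a}" using b by simp
  qed
  then have "card {a \<in> {1..n}. x \<notin> I a} \<le> card {1..<a}" by (intro card_mono) auto
  then have "card {a \<in> {1..n}. x \<notin> I a} \<le> a - 1" by simp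
  then show "level I x \<le> a" using a unfolding level_def atLeastAtMost_iff by linarith
next
  assume le: "level I x \<le> a"
  show "x \<in> I a"
  proof (rule ccontr)
    assume "x \<notin> I a"
    moreover have "{1..a} \<subseteq> {b \<in> {1..n}. x \<notin> I b}" if "x \<notin> I a"
    proof
      fix b assume b: "b \<in> {1..a}"
      then have "b \<in> {1..n}" using a by auto
      then show "b \<in> {b \<in> {1..n}. x \<notin> I b}" using mono[of b a] a b that by auto
    qed
    ultimately have "{1..a} \<subseteq> {b \<in> {1..n}. x \<notin> I b}" by blast
    then have "card {1..a} \<le> card {a \<in> {1..n}. x \<notin> I a}" by (intro card_mono) auto
    then show False using le by (simp add: level_def)
  qed
qed

lemma level_initial:
  assumes "a \<in> {1..n}" "l \<in> initial w a"
  shows "level (initial w) l \<in> {1..n}" "l \<in> initial w (level (initial w) l)"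
    "initial w (level (initial w) l) \<subseteq> initial w a"
proof -
  have le: "level (initial w) l \<le> a" using level_le_iff[of "initial w" a l] initial_mono assms by blast
  then show lv: "level (initial w) l \<in> {1..n}" using assms by (auto simp: level_def)
  then show "l \<in> initial w (level (initial w) l)"
    using level_le_iff[of "initial w" "level (initial w) l" l] initial_mono by blast
  show "initial w (level (initial w) l) \<subseteq> initial w a"
    using initial_mono[OF lv assms(1) le] .
qed

end

section \<open>Reduced echelon coordinates\<close>

lemma polyfn_if: "polyfn p \<Longrightarrow> polyfn q \<Longrightarrow> polyfn (\<lambda>x. if b then p x else q x)"
  by (cases b) simp_all

lemma aff_zero: "z \<in> aff d \<Longrightarrow> k \<notin> {1..d} \<Longrightarrow> z k = 0"
  by (auto simp: aff_def)

context flag_type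
begin

text \<open>Positions above the diagonal that column operations cannot clear: column j may be used
  to clear row j of column l only if j already lies in the first set that contains l. Their number
  becomes the dimension of the cell.\<close>

definition free_entries :: "(nat \<Rightarrow> nat) \<Rightarrow> (nat \<times> nat) set" where
  "free_entries w = {(j,l). l \<in> {1..N} \<and> j \<in> {1..<l} \<and> (\<exists>a\<in>{1..n}. l \<in> initial w a \<and> j \<notin> initial w a)}"

definition unitri :: "(nat \<Rightarrow> nat) \<Rightarrow> (nat \<times> nat \<Rightarrow> complex) \<Rightarrow> matr" where
  "unitri w c = (\<lambda>(i,l). if i = l \<and> l \<in> {1..N} then 1 else if (i,l) \<in> free_entries w then c (i,l) else 0)"

lemma finite_free_entries: "finite (free_entries w)"
  by (rule finite_subset[of _ "{1..N} \<times> {1..N}"]) (auto simp: free_entries_def)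

lemma unitri_Borel: "unitri w c \<in> Borel N"
proof (rule BorelI)
  show "mat_supp N (unitri w c)"
    by (auto simp: mat_supp_def unitri_def free_entries_def split: if_splits)
  show "lead_at (colv (unitri w c) k) k" if "k \<in> {1..N}" for k
    using that by (auto simp: lead_at_def colv_def unitri_def free_entries_def)
qed

lemma unitri_reduced:
  assumes w: "w permutes {1..N}" and a: "a \<in> {1..n}" "l \<in> initial w a"
    and j: "j \<in> initial w (level (initial w) l)"
  shows "unitri w c (j,l) = (if j = l then 1 else 0)"
proof -
  have "l \<in> {1..N}" using initial_subset[OF w a(1)] a(2) by blast
  moreover have "(j,l) \<notin> free_entries w"
    using level_initial(3)[of _ l w] j unfolding free_entries_def by blast
  ultimately show ?thesis by (simp add: unitri_def)
qed

definition chart :: "(nat \<Rightarrow> nat) \<Rightarrow> (nat \<times> nat \<Rightarrow> complex) \<Rightarrow> flag" where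
  "chart w c = frame N n f (mmul N (unitri w c) (perm_mat N w))"

lemma chart_cell: "w permutes {1..N} \<Longrightarrow> chart w c \<in> cell (initial w)"
  unfolding chart_def by (rule Borel_frame_cell[OF _ unitri_Borel])

lemma chart_column:
  assumes w: "w permutes {1..N}" and a: "a \<in> {1..n}" "l \<in> initial w a"
  shows "colv (unitri w c) l \<in> chart w c (level (initial w) l)"
  unfolding chart_def frame_mmul_perm_mat[OF w level_initial(1)[OF a]]
  using level_initial(2)[OF a] by (intro V.span_base imageI)

lemma cell_column_unique:
  assumes U: "U \<in> cell (initial w)" and w: "w permutes {1..N}" and a: "a \<in> {1..n}" "l \<in> initial w a"
    and y: "y \<in> U (level (initial w) l)" "\<And>j. j \<in> initial w (level (initial w) l) \<Longrightarrow> y j = (if j = l then 1 else 0)"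
    and y': "y' \<in> U (level (initial w) l)" "\<And>j. j \<in> initial w (level (initial w) l) \<Longrightarrow> y' j = (if j = l then 1 else 0)"
  shows "y = y'"
proof -
  have UF: "U \<in> Fl N n f" and L: "leads (U (level (initial w) l)) = initial w (level (initial w) l)"
    using U level_initial(1)[OF a] by (auto simp: cell_def)
  show ?thesis
    using eq_on_leads[OF Fl_D(1,2)[OF UF level_initial(1)[OF a]] y(1) y'(1)] y(2) y'(2) unfolding L by simp
qed

text \<open>Column l is the only vector of its space with the prescribed coordinates at the leads,
  so the flag determines it.\<close>

lemma chart_inj:
  assumes w: "w permutes {1..N}" and eq: "chart w c = chart w c'" and jl: "(j,l) \<in> free_entries w"
  shows "c (j,l) = c' (j,l)"
proof -
  obtain a where a: "a \<in> {1..n}" "l \<in> initial w a" using jl by (auto simp: free_entries_def)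
  have "colv (unitri w c) l = colv (unitri w c') l"
  proof (rule cell_column_unique[OF chart_cell[OF w] w a])
    show "colv (unitri w c) l \<in> chart w c (level (initial w) l)" by (rule chart_column[OF w a])
    show "colv (unitri w c') l \<in> chart w c (level (initial w) l)"
      unfolding eq by (rule chart_column[OF w a])
  qed (simp_all add: colv_def unitri_reduced[OF w a])
  then have "unitri w c (j,l) = unitri w c' (j,l)" by (simp add: colv_def fun_eq_iff)
  then show ?thesis using jl by (auto simp: unitri_def free_entries_def split: if_splits)
qed

lemma chart_surj:
  assumes w: "w permutes {1..N}" and U: "U \<in> cell (initial w)"
    and y: "\<And>a l. a \<in> {1..n} \<Longrightarrow> l \<in> initial w a \<Longrightarrow> y l \<in> U (level (initial w) l) \<and>
      (\<forall>j\<in>initial w (level (initial w) l). y l j = (if j = l then 1 else 0))"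
  shows "chart w (\<lambda>(j,l). y l j) = U"
proof -
  let ?c = "\<lambda>(j,l). y l j"
  have UF: "U \<in> Fl N n f" and L: "\<And>a. a \<in> {1..n} \<Longrightarrow> leads (U a) = initial w a"
    using U by (auto simp: cell_def)
  have col: "colv (unitri w ?c) l = y l" if a: "a \<in> {1..n}" "l \<in> initial w a" for a l
  proof
    fix i
    let ?b = "level (initial w) l"
    note b = level_initial[OF a]
    have l: "l \<in> {1..N}" using initial_subset[OF w a(1)] a(2) by blast
    have yl: "y l \<in> U ?b" "\<And>j. j \<in> initial w ?b \<Longrightarrow> y l j = (if j = l then 1 else 0)"
      using y[OF a] by auto
    have yN: "y l \<in> coord {1..N}" using yl(1) Fl_D(2)[OF UF b(1)] by blast
    have "y l l = 1" using yl(2)[OF b(2)] by simp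
    then have "y l \<noteq> 0" by auto
    then obtain k where k: "lead_at (y l) k" using exists_lead yN by blast
    then have "k \<in> leads (U ?b)" using yl(1) by (auto simp: leads_def)
    then have "k \<in> initial w ?b" unfolding L[OF b(1)] .
    \<comment> \<open>k is a lead of the space, and among these positions y l is nonzero only at
      l.\<close>
    then have "k = l" using yl(2)[of k] k by (auto simp: lead_at_def split: if_splits)
    then have lead: "lead_at (y l) l" using k by simp
    consider "i = l" | "(i,l) \<in> free_entries w" | "i \<noteq> l" "(i,l) \<notin> free_entries w" by blast
    then show "colv (unitri w ?c) l i = y l i"
    proof cases
      case 1
      then show ?thesis using l \<open>y l l = 1\<close> by (simp add: colv_def unitri_def)
    next
      case 2
      then show ?thesis by (auto simp: colv_def unitri_def free_entries_def)
    next
      case 3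
      have "y l i = 0"
      proof (cases "i \<in> {1..<l}")
        case True
        then have "i \<in> initial w ?b" using 3(2) l b by (auto simp: free_entries_def)
        then show ?thesis using yl(2) 3(1) by simp
      next
        case False
        then have "i = 0 \<or> i > l" using 3(1) by auto
        then show ?thesis using lead yN by (auto simp: lead_at_def coord_def)
      qed
      then show ?thesis using 3 by (simp add: colv_def unitri_def)
    qed
  qed
  show ?thesis
  proof (rule Fl_eq_by_leads)
    show "chart w ?c \<in> Fl N n f" "U \<in> Fl N n f"
      using chart_cell[OF w, of ?c] UF by (auto simp: cell_def)
    fix a assume a: "a \<in> {1..n}"
    show "leads (chart w ?c a) = leads (U a)"
      using chart_cell[OF w, of ?c] L[OF a] a by (auto simp: cell_def)
    have "y l \<in> U a" if l: "l \<in> initial w a" for l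
    proof -
      have "level (initial w) l \<le> a"
        using level_le_iff[of "initial w" a l] initial_mono a l by blast
      then show ?thesis using y[OF a l] Fl_mono[OF UF level_initial(1)[OF a l] a] by blast
    qed
    then show "chart w ?c a \<subseteq> U a"
      unfolding chart_def frame_mmul_perm_mat[OF w a] using col[OF a] Fl_D(1)[OF UF a]
      by (intro V.span_minimal) auto
  qed
qed

text \<open>Bundles the output of \<open>echelon_vector\<close> for one l. The same p and q serve
  for all frames over the cell, which is what makes the inverse of the chart regular.\<close>

definition echelon_quotient :: "(nat \<Rightarrow> nat) \<Rightarrow> nat \<Rightarrow> (nat \<Rightarrow> matr \<Rightarrow> complex) \<Rightarrow> (matr \<Rightarrow> complex) \<Rightarrow> bool" where
  "echelon_quotient w l p q \<longleftrightarrow> polyfn q \<and> (\<forall>i. polyfn (p i)) \<and>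
    (\<forall>g\<in>GL N. frame N n f g \<in> cell (initial w) \<longrightarrow>
      q g \<noteq> 0 \<and> (\<lambda>i. p i g / q g) \<in> frame N n f g (level (initial w) l) \<and>
      (\<forall>j\<in>initial w (level (initial w) l). p j g / q g = (if j = l then 1 else 0)))"

lemma echelon_quotient_exists:
  assumes w: "w permutes {1..N}" and a: "a \<in> {1..n}" "l \<in> initial w a"
  shows "\<exists>p q. echelon_quotient w l p q"
proof -
  let ?lev = "level (initial w)"
  note b = level_initial[OF a]
  have fin: "finite (initial w (?lev l))" by (simp add: initial_def)
  have card: "card (initial w (?lev l)) = f (?lev l)"
    unfolding initial_def using permutes_inj[OF w] by (simp add: card_image inj_on_subset[OF _ subset_UNIV])
  have fr: "frame N n f g (?lev l) = vspan (colv g ` {1..f (?lev l)})" for g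
    using b(1) by (simp add: frame_eq)
  have lead: "leads (vspan (colv g ` {1..f (?lev l)})) = initial w (?lev l)"
    if "frame N n f g \<in> cell (initial w)" for g
    using that b(1) unfolding cell_def fr[symmetric] by blast
  show ?thesis
  proof (rule echelon_vector[OF fin card b(2) f_le[OF b(1)]])
    fix p q assume pq: "polyfn q" "\<And>i. polyfn (p i)"
      "\<And>g. g \<in> GL N \<Longrightarrow> leads (vspan (colv g ` {1..f (?lev l)})) = initial w (?lev l) \<Longrightarrow>
        q g \<noteq> 0 \<and> (\<lambda>i. p i g / q g) \<in> vspan (colv g ` {1..f (?lev l)}) \<and>
        (\<forall>j\<in>initial w (?lev l). p j g / q g = (if j = l then 1 else 0))"
    have "echelon_quotient w l p q"
      unfolding echelon_quotient_def fr
    proof (intro conjI allI ballI impI)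
      fix g assume g: "g \<in> GL N" "frame N n f g \<in> cell (initial w)"
      note r = pq(3)[OF g(1) lead[OF g(2)]]
      show "q g \<noteq> 0" "(\<lambda>i. p i g / q g) \<in> vspan (colv g ` {1..f (?lev l)})" using r by auto
      show "p j g / q g = (if j = l then 1 else 0)" if "j \<in> initial w (?lev l)" for j using r that by blast
    qed (rule pq(1), rule pq(2))
    then show ?thesis by (intro exI)
  qed
qed

text \<open>The coordinates are the free entries of the reduced echelon frame, enumerated by h. The
  inverse reads them off an arbitrary frame as echelon quotients.\<close>

lemma cell_parametrization:
  assumes w: "w permutes {1..N}"
  obtains d \<phi> where "\<And>ij. polyfn (\<lambda>z. \<phi> z ij)" "\<And>z. \<phi> z \<in> GL N"
    "bij_betw (\<lambda>z. frame N n f (\<phi> z)) (aff d) (cell (initial w))"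
    "\<And>k. regular_on (GL N \<inter> frame N n f -` cell (initial w))
      (\<lambda>g. inv_into (aff d) (\<lambda>z. frame N n f (\<phi> z)) (frame N n f g) k)"
proof -
  define d where "d = card (free_entries w)"
  obtain h where h: "bij_betw h {1..d} (free_entries w)"
    using ex_bij_betw_nat_finite_1[OF finite_free_entries] unfolding d_def by blast
  define e where "e = inv_into {1..d} h"
  have eh: "e (h k) = k" if "k \<in> {1..d}" for k
    unfolding e_def using h that by (simp add: bij_betw_def)
  have he: "h (e x) = x" "e x \<in> {1..d}" if "x \<in> free_entries w" for x
    using f_inv_into_f[of x h "{1..d}"] inv_into_into[of x h "{1..d}"] h that
    unfolding e_def bij_betw_def by blast+
  have hk: "h k \<in> free_entries w" if "k \<in> {1..d}" for k
    using h that by (auto simp: bij_betw_def)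
  define \<phi> where "\<phi> z = mmul N (unitri w (\<lambda>x. z (e x))) (perm_mat N w)" for z :: "nat \<Rightarrow> complex"
  define \<psi> where "\<psi> = (\<lambda>z. frame N n f (\<phi> z))"
  have \<psi>: "\<psi> z = chart w (\<lambda>x. z (e x))" for z by (simp add: \<psi>_def \<phi>_def chart_def)
  \<comment> \<open>One simultaneous choice for all l; its defining property is available for those
    l that occur in some \<open>initial w a\<close>.\<close>
  define r where "r l = (SOME pq. echelon_quotient w l (fst pq) (snd pq))" for l
  define p where "p l = fst (r l)" for l
  define q where "q l = snd (r l)" for l
  have r: "echelon_quotient w l (p l) (q l)" if a: "a \<in> {1..n}" "l \<in> initial w a" for a l
  proof -
    obtain p' q' where "echelon_quotient w l p' q'" using echelon_quotient_exists[OF w a] by blast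
    then have "echelon_quotient w l (fst (p',q')) (snd (p',q'))" by simp
    then show ?thesis unfolding p_def q_def r_def by (rule someI)
  qed
  have poly: "polyfn (q l)" "polyfn (p l i)" if "a \<in> {1..n}" "l \<in> initial w a" for a l i
    using r[OF that] unfolding echelon_quotient_def by blast+
  have pq: "q l g \<noteq> 0" "(\<lambda>i. p l i g / q l g) \<in> frame N n f g (level (initial w) l)"
    "\<forall>j\<in>initial w (level (initial w) l). p l j g / q l g = (if j = l then 1 else 0)"
    if "a \<in> {1..n}" "l \<in> initial w a" "g \<in> GL N" "frame N n f g \<in> cell (initial w)" for a l g
    using r[OF that(1,2)] that(3,4) unfolding echelon_quotient_def by blast+
  have inj: "inj_on \<psi> (aff d)"
  proof (rule inj_onI, rule ext)
    fix z z' k assume z: "z \<in> aff d" "z' \<in> aff d" "\<psi> z = \<psi> z'"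
    show "z k = z' k"
    proof (cases "k \<in> {1..d}")
      case True
      obtain j l where jl: "h k = (j,l)" by (cases "h k")
      have "z (e (j,l)) = z' (e (j,l))"
        using chart_inj[OF w, of "\<lambda>x. z (e x)" "\<lambda>x. z' (e x)"] z(3) hk[OF True] unfolding \<psi> jl by blast
      then show ?thesis using eh[OF True] jl by simp
    next
      case False
      show ?thesis using aff_zero[OF z(1) False] aff_zero[OF z(2) False] by simp
    qed
  qed
  \<comment> \<open>Stated for frames and with an explicit preimage, because regularity of the
    inverse is tested on frames.\<close>
  have surj: "\<exists>z\<in>aff d. \<psi> z = frame N n f g \<and> (\<forall>k\<in>{1..d}. z k = p (snd (h k)) (fst (h k)) g / q (snd (h k)) g)"
    if g: "g \<in> GL N" "frame N n f g \<in> cell (initial w)" for g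
  proof -
    define z where "z k = (if k \<in> {1..d} then p (snd (h k)) (fst (h k)) g / q (snd (h k)) g else 0)" for k
    have "unitri w (\<lambda>x. z (e x)) = unitri w (\<lambda>(j,l). p l j g / q l g)"
    proof -
      have "z (e (j,l)) = p l j g / q l g" if "(j,l) \<in> free_entries w" for j l
        using he[OF that] by (simp add: z_def del: atLeastAtMost_iff)
      then show ?thesis by (auto simp: unitri_def fun_eq_iff)
    qed
    then have "\<psi> z = chart w (\<lambda>(j,l). p l j g / q l g)" unfolding \<psi> by (simp add: chart_def)
    also have "\<dots> = frame N n f g"
      by (rule chart_surj[OF w g(2)], intro conjI pq(2,3)[OF _ _ g]; assumption)
    finally have "\<psi> z = frame N n f g" .
    then show ?thesis by (intro bexI[of _ z]) (auto simp: z_def aff_def)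
  qed
  have GL: "\<phi> z \<in> GL N" for z
    unfolding \<phi>_def using unitri_Borel perm_mat_GL[OF w] mmul_GL by (auto simp: Borel_def)
  have image: "\<psi> ` aff d = cell (initial w)"
  proof
    show "\<psi> ` aff d \<subseteq> cell (initial w)" using chart_cell[OF w] \<psi> by auto
    show "cell (initial w) \<subseteq> \<psi> ` aff d"
    proof
      fix U assume U: "U \<in> cell (initial w)"
      obtain b where b: "b \<in> Borel N" "U = frame N n f (mmul N b (perm_mat N w))"
        using cell_Borel_frame[OF w U] by blast
      have "mmul N b (perm_mat N w) \<in> GL N"
        using b(1) perm_mat_GL[OF w] mmul_GL by (auto simp: Borel_def)
      then obtain z where "z \<in> aff d" "\<psi> z = U" using surj U b(2) by blast
      then show "U \<in> \<psi> ` aff d" by blast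
    qed
  qed
  show thesis
  proof
    show "polyfn (\<lambda>z. \<phi> z ij)" for ij
    proof -
      have "polyfn (\<lambda>z. unitri w (\<lambda>x. z (e x)) (i,k))" for i k
        unfolding unitri_def prod.case by (intro polyfn_if pvar pconst)
      then show ?thesis
        unfolding \<phi>_def mmul_def by (cases ij) (auto intro!: polyfn_sum pmult pconst)
    qed
    show "\<phi> z \<in> GL N" for z by (rule GL)
    show "bij_betw (\<lambda>z. frame N n f (\<phi> z)) (aff d) (cell (initial w))"
      using inj image unfolding bij_betw_def \<psi>_def by blast
    show "regular_on (GL N \<inter> frame N n f -` cell (initial w))
      (\<lambda>g. inv_into (aff d) (\<lambda>z. frame N n f (\<phi> z)) (frame N n f g) k)" for k
      unfolding \<psi>_def[symmetric]
    proof (cases "k \<in> {1..d}")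
      case True
      obtain j l where jl: "h k = (j,l)" by (cases "h k")
      then obtain a where a: "a \<in> {1..n}" "l \<in> initial w a"
        using hk[OF True] by (auto simp: free_entries_def)
      show "regular_on (GL N \<inter> frame N n f -` cell (initial w)) (\<lambda>g. inv_into (aff d) \<psi> (frame N n f g) k)"
      proof (rule regular_onI[OF poly(2)[OF a, of j] poly(1)[OF a]])
        fix g assume "g \<in> GL N \<inter> frame N n f -` cell (initial w)"
        then have g: "g \<in> GL N" "frame N n f g \<in> cell (initial w)" by auto
        obtain z where z: "z \<in> aff d" "\<psi> z = frame N n f g"
          "\<forall>k\<in>{1..d}. z k = p (snd (h k)) (fst (h k)) g / q (snd (h k)) g"
          using surj[OF g] by (elim bexE conjE)
        have zk: "z k = p l j g / q l g" using bspec[OF z(3) True] jl by simp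
        have "inv_into (aff d) \<psi> (frame N n f g) = z"
          using inv_into_f_f[OF inj z(1)] z(2) by simp
        then show "q l g \<noteq> 0 \<and> inv_into (aff d) \<psi> (frame N n f g) k = p l j g / q l g"
          using zk pq(1)[OF a g] by simp
      qed
    next
      case False
      show "regular_on (GL N \<inter> frame N n f -` cell (initial w)) (\<lambda>g. inv_into (aff d) \<psi> (frame N n f g) k)"
      proof (rule regular_onI[OF pconst[of 0] pconst[of 1]])
        fix g assume "g \<in> GL N \<inter> frame N n f -` cell (initial w)"
        then have "frame N n f g \<in> \<psi> ` aff d" unfolding image by blast
        then have "inv_into (aff d) \<psi> (frame N n f g) \<in> aff d" by (rule inv_into_into)
        then show "1 \<noteq> (0::complex) \<and> inv_into (aff d) \<psi> (frame N n f g) k = 0 / 1"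
          using aff_zero[OF _ False] by simp
      qed
    qed
  qed
qed

lemma affine_cell_cell:
  assumes w: "w permutes {1..N}"
  shows "affine_cell N n f (cell (initial w))"
proof -
  obtain d \<phi> where \<phi>: "\<And>ij. polyfn (\<lambda>z. \<phi> z ij)" "\<And>z. \<phi> z \<in> GL N"
    and bij: "bij_betw (\<lambda>z. frame N n f (\<phi> z)) (aff d) (cell (initial w))"
    and reg: "\<And>k. regular_on (GL N \<inter> frame N n f -` cell (initial w))
      (\<lambda>g. inv_into (aff d) (\<lambda>z. frame N n f (\<phi> z)) (frame N n f g) k)"
    using cell_parametrization[OF w] by metis
  have "fl_morphism N n f (aff d) (\<lambda>z. frame N n f (\<phi> z))"
    unfolding fl_morphism_def
  proof (rule ballI, rule exI[of _ UNIV], rule exI[of _ \<phi>], intro conjI allI)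
    show "regular_on (aff d \<inter> UNIV) (\<lambda>z. \<phi> z ij)" for ij
      by (rule regular_onI[OF \<phi>(1)[of ij] pconst[of 1]]) simp
  qed (use \<phi>(2) openin_zar_self in auto)
  with bij reg show ?thesis
    unfolding affine_cell_def by (intro exI[of _ d] exI[of _ "\<lambda>z. frame N n f (\<phi> z)"]) blast
qed

lemma irreducible_cell:
  assumes w: "w permutes {1..N}"
  shows "irreducible_in (fl_top N n f) (cell (initial w))"
proof -
  obtain d \<phi> where \<phi>: "\<And>ij. polyfn (\<lambda>z. \<phi> z ij)" "\<And>z. \<phi> z \<in> GL N"
    and bij: "bij_betw (\<lambda>z. frame N n f (\<phi> z)) (aff d) (cell (initial w))"
    using cell_parametrization[OF w] by metis
  have "irreducible_in (fl_top N n f) ((\<lambda>z. frame N n f (\<phi> z)) ` aff d)"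
    by (rule irreducible_param[OF \<phi>])
  then show ?thesis using bij by (simp add: bij_betw_def)
qed

end

section \<open>Closures of cells\<close>

lemma takeWhile_sorted_eq_filter:
  "sorted (map A xs) \<Longrightarrow> takeWhile (\<lambda>x. A x \<le> a) xs = filter (\<lambda>x. A x \<le> a) xs"
  for A :: "'a \<Rightarrow> 'b::linorder"
proof (induction xs)
  case (Cons x xs)
  have "filter (\<lambda>x. A x \<le> a) xs = []" if "\<not> A x \<le> a"
    using Cons.prems that by (intro filter_False) (auto dest: order_trans)
  then show ?case using Cons by auto
qed simp

lemma perm_of_list:
  assumes "distinct xs" "set xs = {1..N}"
  obtains w where "w permutes {1..N}" "\<And>k. k \<le> N \<Longrightarrow> w ` {1..k} = set (take k xs)"
proof -
  have len: "length xs = N" using distinct_card[OF assms(1)] assms(2) by simp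
  define w where "w i = (if i \<in> {1..N} then xs ! (i - 1) else i)" for i
  have im: "w ` {1..k} = set (take k xs)" if k: "k \<le> N" for k
  proof -
    have "w ` {1..k} = (\<lambda>i. xs ! (i - 1)) ` {1..k}"
      using k by (intro image_cong) (auto simp: w_def)
    also have "\<dots> = (\<lambda>i. xs ! (i - 1)) ` Suc ` {0..<k}"
      by (simp add: atLeastLessThanSuc_atLeastAtMost)
    also have "\<dots> = (!) xs ` {0..<k}"
      by (simp only: image_image diff_Suc_1)
    also have "\<dots> = set (take k xs)" using k len by (intro nth_image) simp
    finally show ?thesis .
  qed
  have surj: "w ` {1..N} = {1..N}" using im[of N] assms(2) len by simp
  have "w permutes {1..N}"
  proof (rule bij_imp_permutes)
    show "bij_betw w {1..N} {1..N}"
      unfolding bij_betw_def using surj by (simp add: eq_card_imp_inj_on)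
    show "w x = x" if "x \<notin> {1..N}" for x using that unfolding w_def by (rule if_not_P)
  qed
  then show thesis using that im by blast
qed

context flag_type
begin

definition sublevel :: "(nat \<Rightarrow> nat) \<Rightarrow> nat \<Rightarrow> nat set" where
  "sublevel A a = {x \<in> {1..N}. A x \<le> a}"

text \<open>Sorting the positions by their letters makes each sublevel set an initial segment of the
  list, and the cardinality condition puts its end at f a.\<close>

lemma perm_of_word:
  assumes card: "\<And>a. a \<in> {1..n} \<Longrightarrow> card (sublevel A a) = f a"
  obtains w where "w permutes {1..N}" "\<And>a. a \<in> {1..n} \<Longrightarrow> initial w a = sublevel A a"
proof -
  define xs where "xs = sort_key A [1..<Suc N]"
  have xs: "distinct xs" "set xs = {1..N}" "sorted (map A xs)"
    unfolding xs_def by (auto simp: sorted_sort_key)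
  obtain w where w: "w permutes {1..N}" "\<And>k. k \<le> N \<Longrightarrow> w ` {1..k} = set (take k xs)"
    using perm_of_list[OF xs(1,2)] by metis
  have "initial w a = sublevel A a" if a: "a \<in> {1..n}" for a
  proof -
    let ?F = "filter (\<lambda>x. A x \<le> a) xs"
    have set: "set ?F = sublevel A a" using xs(2) by (auto simp: sublevel_def)
    have len: "length ?F = f a"
      using distinct_card[of ?F] xs(1) card[OF a] unfolding set by simp
    have "take (f a) xs = ?F"
      using takeWhile_eq_take[of "\<lambda>x. A x \<le> a" xs]
      unfolding takeWhile_sorted_eq_filter[OF xs(3)] len by simp
    then show ?thesis unfolding initial_def w(2)[OF f_le[OF a]] using set by simp
  qed
  with w(1) show thesis using that by blast
qed

lemma cell_subset_Fl: "cell I \<subseteq> Fl N n f"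
  by (auto simp: cell_def)

text \<open>Adding z times column k' to column k moves the flag into the larger cell for every nonzero z,
  so the smaller cell consists of limits of such curves at z = 0.\<close>
lemma cell_swap:
  assumes card: "\<And>a. a \<in> {1..n} \<Longrightarrow> card (sublevel A a) = f a"
    and k: "1 \<le> k" "k < k'" "k' \<le> N" "A k < A k'"
    and C: "closedin (fl_top N n f) C" "cell (sublevel (A \<circ> transpose k k')) \<subseteq> C"
  shows "cell (sublevel A) \<subseteq> C"
proof
  fix U assume U: "U \<in> cell (sublevel A)"
  obtain w where w: "w permutes {1..N}" and wA: "\<And>a. a \<in> {1..n} \<Longrightarrow> initial w a = sublevel A a"
    using perm_of_word[OF card] by metis
  have "U \<in> cell (initial w)" using U wA by (simp add: cell_def)
  then obtain b where b: "b \<in> Borel N" and Ub: "U = frame N n f (mmul N b (perm_mat N w))"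
    using cell_Borel_frame[OF w] by blast
  define E where "E z = (\<lambda>(i,j). b (i,j) + (if j = k then z * b (i,k') else 0))" for z
  define g where "g z = mmul N (E z) (perm_mat N w)" for z
  have bGL: "b \<in> GL N" using b by (simp add: Borel_def)
  have kk: "k \<in> {1..N}" "k' \<in> {1..N}" using k by auto
  have EGL: "E z \<in> GL N" for z
    unfolding GL_iff_kernel
  proof (intro conjI allI impI)
    have "b (i,j) = 0" if "i \<notin> {1..N} \<or> j \<notin> {1..N}" for i j
      using bGL that unfolding GL_def mat_supp_def by blast
    then have "E z (i,j) = 0" if "i \<notin> {1..N} \<or> j \<notin> {1..N}" for i j
      using that kk unfolding E_def prod.case by (metis add_0 mult_zero_right)
    then show "mat_supp N (E z)" unfolding mat_supp_def by blast
    fix c assume c: "\<forall>i\<in>{1..N}. (\<Sum>j\<in>{1..N}. E z (i,j) * c j) = 0"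
    \<comment> \<open>\<open>E z\<close> is b times an elementary matrix, and c' is the image of c
      under that matrix; so the kernel of \<open>E z\<close> is trivial because that of b
      is.\<close>
    define c' where "c' = c(k' := c k' + z * c k)"
    have "(\<Sum>j\<in>{1..N}. b (i,j) * c' j) = (\<Sum>j\<in>{1..N}. E z (i,j) * c j)" for i
    proof -
      have "(\<Sum>j\<in>{1..N}. b (i,j) * c' j) = (\<Sum>j\<in>{1..N}. b (i,j) * c j + (if j = k' then b (i,k') * (z * c k) else 0))"
        by (rule sum.cong) (auto simp: c'_def algebra_simps)
      also have "\<dots> = (\<Sum>j\<in>{1..N}. b (i,j) * c j) + b (i,k') * (z * c k)"
        using kk by (simp add: sum.distrib del: atLeastAtMost_iff)
      also have "\<dots> = (\<Sum>j\<in>{1..N}. b (i,j) * c j + (if j = k then z * b (i,k') * c k else 0))"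
        using kk by (simp add: sum.distrib del: atLeastAtMost_iff)
      also have "\<dots> = (\<Sum>j\<in>{1..N}. E z (i,j) * c j)"
        by (rule sum.cong) (auto simp: E_def algebra_simps)
      finally show ?thesis .
    qed
    then have c'0: "\<forall>i\<in>{1..N}. (\<Sum>j\<in>{1..N}. b (i,j) * c' j) = 0" using c by simp
    have c0: "\<forall>j\<in>{1..N}. c' j = 0"
      using bGL[unfolded GL_iff_kernel, THEN conjunct2, THEN spec, of c'] c'0 by (rule mp)
    have "c k = 0" using bspec[OF c0 kk(1)] k by (simp add: c'_def)
    then show "\<forall>j\<in>{1..N}. c j = 0" using c0 by (auto simp: c'_def split: if_splits)
  qed
  have gGL: "g z \<in> GL N" for z unfolding g_def using EGL perm_mat_GL[OF w] mmul_GL by blast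
  have colE: "colv (E z) j = (if j = k then colv b k + sc z (colv b k') else colv b j)" for z j
    by (auto simp: colv_def E_def sc_def fun_eq_iff)
  have "frame N n f (g z) \<in> cell (sublevel (A \<circ> transpose k k'))" if z: "z \<noteq> 0" for z
    unfolding cell_def
  proof (intro CollectI conjI ballI)
    show F: "frame N n f (g z) \<in> Fl N n f" using frame_Fl[OF gGL] .
    fix a assume a: "a \<in> {1..n}"
    let ?S = "sublevel A a" and ?S' = "sublevel (A \<circ> transpose k k') a"
    have fr: "frame N n f (g z) a = vspan (colv (E z) ` ?S)"
      unfolding g_def frame_mmul_perm_mat[OF w a] wA[OF a] ..
    have base: "colv (E z) j \<in> vspan (colv (E z) ` ?S)" if "j \<in> ?S" for j
      using that by (intro V.span_base imageI)
    have "j \<in> leads (vspan (colv (E z) ` ?S))" if j: "j \<in> ?S'" for j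
    proof -
      \<comment> \<open>Since A k < A k', a sublevel set containing k' contains k. If it contains
        both, the column operation leaves the span unchanged; if only k, the lead k is replaced by
        k'.\<close>
      consider "j = k" | "j = k'" | "j \<noteq> k" "j \<noteq> k'" by blast
      then show ?thesis
      proof cases
        case 1
        then have "k \<in> ?S" "k' \<in> ?S" using j k kk by (auto simp: sublevel_def)
        then have "colv (E z) k - sc z (colv (E z) k') \<in> vspan (colv (E z) ` ?S)"
          using base by (intro V.span_diff V.span_scale)
        moreover have "colv (E z) k - sc z (colv (E z) k') = colv b k" using k(2) by (simp add: colE)
        ultimately show ?thesis using Borel_lead[OF b kk(1)] 1 unfolding leads_def by auto
      next
        case 2
        then have "k \<in> ?S" using j kk by (auto simp: sublevel_def)
        moreover have "lead_at (colv (E z) k) k'"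
          using Borel_lead[OF b kk(1)] Borel_lead[OF b kk(2)] k(2) z
          by (auto simp: lead_at_def colE sc_apply)
        ultimately show ?thesis using base 2 unfolding leads_def by blast
      next
        case 3
        then have "j \<in> ?S" using j by (auto simp: sublevel_def transpose_def)
        moreover have "lead_at (colv (E z) j) j"
          using Borel_lead[OF b, of j] j 3 by (simp add: colE sublevel_def)
        ultimately show ?thesis using base unfolding leads_def by blast
      qed
    qed
    then have sub: "?S' \<subseteq> leads (frame N n f (g z) a)" unfolding fr by blast
    \<comment> \<open>The inclusion of leads is enough: an exchange inside {1..N} preserves the
      number of letters up to a, so both sides have f a elements.\<close>
    have "card ?S' = card ?S"
      using rk_swap_above[OF k(1-3), of A a] by (simp only: rk_card sublevel_def)
    then have "card ?S' = card (leads (frame N n f (g z) a))"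
      using card[OF a] Fl_D(3)[OF F a] by simp
    moreover have "finite (leads (frame N n f (g z) a))"
      using leads_subset[OF Fl_D(2)[OF F a]] finite_subset by blast
    ultimately show "leads (frame N n f (g z) a) = ?S'" using card_subset_eq[OF _ sub] by simp
  qed
  then have inC: "frame N n f (g z) \<in> C" if "z \<noteq> 0" for z using C(2) that by blast
  obtain P where P: "\<forall>p\<in>P. polyfn p" "\<forall>g\<in>GL N. frame N n f g \<in> C \<longleftrightarrow> (\<forall>p\<in>P. p g = 0)"
    using C(1)[unfolded closedin_fl] by (elim conjE exE)
  have lin: "\<exists>Q. \<forall>z. g z ij = poly Q z" for ij
  proof -
    obtain i j where ij: "ij = (i,j)" by (cases ij)
    show ?thesis
    proof (cases "j \<in> {1..N}")
      case True
      have "g z ij = E z (i, w j)" for z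
        using colv_mmul_perm_mat[OF w True, of "E z"] unfolding g_def ij colv_def by (metis (full_types))
      then have "\<forall>z. g z ij = poly [:b (i, w j), if w j = k then b (i,k') else 0:] z"
        by (simp add: E_def)
      then show ?thesis by (rule exI)
    next
      case False
      then have "g z ij = 0" for z
        using gGL[of z] unfolding ij GL_def mat_supp_def by blast
      then have "\<forall>z. g z ij = poly 0 z" by simp
      then show ?thesis by (rule exI)
    qed
  qed
  have "p (g 0) = 0" if p: "p \<in> P" for p
  proof -
    have "polyfn p" using P(1) p by blast
    then obtain Q where Q: "\<forall>z. p (g z) = poly Q z" using polyfn_curve[where \<phi> = g, OF _ lin] by blast
    have "poly Q z = 0" if "z \<noteq> 0" for z
    proof -
      have "p (g z) = 0" using P(2) inC[OF that] gGL[of z] p by blast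
      then show ?thesis using Q by simp
    qed
    then have "Q = 0" by (rule poly_cofinite_zero)
    then show ?thesis using Q by simp
  qed
  then have "frame N n f (g 0) \<in> C" using P(2) gGL[of 0] by blast
  moreover have "E 0 = b" by (auto simp: E_def)
  ultimately show "U \<in> C" unfolding Ub g_def by simp
qed

lemma sublevel_level:
  assumes mono: "\<And>a b. a \<in> {1..n} \<Longrightarrow> b \<in> {1..n} \<Longrightarrow> a \<le> b \<Longrightarrow> I a \<subseteq> I b"
    and a: "a \<in> {1..n}" and I: "I a \<subseteq> {1..N}"
  shows "sublevel (level I) a = I a"
proof -
  have "level I x \<le> a \<longleftrightarrow> x \<in> I a" for x by (rule level_le_iff[OF mono a])
  then show ?thesis using I unfolding sublevel_def by blast
qed

text \<open>The induction over exchanges asks for every letter bound a. Outside {1..n} nothing needs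
  to be known about the sets: no letter is at most 0, and every letter is at most n + 1.\<close>

lemma rk_level_le:
  assumes I: "\<And>a b. a \<in> {1..n} \<Longrightarrow> b \<in> {1..n} \<Longrightarrow> a \<le> b \<Longrightarrow> I a \<subseteq> I b" "\<And>a. a \<in> {1..n} \<Longrightarrow> I a \<subseteq> {1..N}"
    and J: "\<And>a b. a \<in> {1..n} \<Longrightarrow> b \<in> {1..n} \<Longrightarrow> a \<le> b \<Longrightarrow> J a \<subseteq> J b" "\<And>a. a \<in> {1..n} \<Longrightarrow> J a \<subseteq> {1..N}"
    and le: "\<And>a. a \<in> {1..n} \<Longrightarrow> card (J a \<inter> {..x}) \<le> card (I a \<inter> {..x})" and x: "x \<le> N"
  shows "rk (level J) a x \<le> rk (level I) a x"
proof (cases "a \<in> {1..n}")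
  case True
  have eq: "{y \<in> {1..x}. level K y \<le> a} = K a \<inter> {..x}"
    if "\<And>a b. a \<in> {1..n} \<Longrightarrow> b \<in> {1..n} \<Longrightarrow> a \<le> b \<Longrightarrow> K a \<subseteq> K b" "K a \<subseteq> {1..N}" for K
  proof -
    have "level K y \<le> a \<longleftrightarrow> y \<in> K a" for y by (rule level_le_iff[OF that(1) True])
    then show ?thesis using that(2) by auto
  qed
  have "{y \<in> {1..x}. level I y \<le> a} = I a \<inter> {..x}" by (rule eq) (rule I(1) I(2)[OF True]; assumption?)+
  moreover have "{y \<in> {1..x}. level J y \<le> a} = J a \<inter> {..x}" by (rule eq) (rule J(1) J(2)[OF True]; assumption?)+
  ultimately show ?thesis unfolding rk_card using le[OF True] by (simp only:)
next
  case False
  have "level K y \<le> Suc n" for K y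
  proof -
    have "card {a \<in> {1..n}. y \<notin> K a} \<le> card {1..n}" by (intro card_mono) auto
    then show ?thesis by (simp add: level_def)
  qed
  then have large: "level K y \<le> a" if "a > n" for K y using that by (meson Suc_leI order_trans)
  have "{y \<in> {1..x}. level J y \<le> 0} = {}" by (auto simp: level_def)
  then have "a = 0 \<Longrightarrow> rk (level J) a x = 0" unfolding rk_card by simp
  moreover have "rk (level J) a x = rk (level I) a x" if "a > n"
    using large[OF that] by (simp add: rk_def)
  moreover have "a = 0 \<or> a > n" using False by auto
  ultimately show ?thesis by auto
qed

lemma sublevel_level_initial:
  assumes "w permutes {1..N}" "a \<in> {1..n}"
  shows "sublevel (level (initial w)) a = initial w a"
proof (rule sublevel_level[where I = "initial w"])
  show "initial w b \<subseteq> initial w c" if "b \<in> {1..n}" "c \<in> {1..n}" "b \<le> c" for b c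
    using initial_mono[OF that] .
qed (use assms initial_subset in auto)

text \<open>Necessity: the closed set \<open>schubert\<close> contains the larger cell, and
  membership in it depends only on leads, so a single flag of the smaller cell decides. Sufficiency:
  \<open>bruhat_induct\<close> starts from the larger cell, and each step back is a limit supplied
  by \<open>cell_swap\<close>.\<close>

lemma cell_closure_iff:
  assumes w: "w permutes {1..N}" and w': "w' permutes {1..N}"
  shows "cell (initial w) \<subseteq> fl_top N n f closure_of cell (initial w') \<longleftrightarrow> below (initial w) (initial w')"
proof
  assume sub: "cell (initial w) \<subseteq> fl_top N n f closure_of cell (initial w')"
  have "cell (initial w') \<subseteq> schubert (initial w')"
    by (auto simp: cell_def schubert_def below_def)
  then have "fl_top N n f closure_of cell (initial w') \<subseteq> schubert (initial w')"
    using closedin_schubert by (rule closure_of_minimal)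
  moreover have "cell (initial w) \<noteq> {}"
    using irreducible_cell[OF w] by (simp add: irreducible_in_def)
  ultimately obtain U where "U \<in> cell (initial w)" "U \<in> schubert (initial w')" using sub by blast
  then show "below (initial w) (initial w')" by (auto simp: cell_def schubert_def below_def)
next
  assume below: "below (initial w) (initial w')"
  let ?A = "level (initial w)" and ?B = "level (initial w')"
  let ?cl = "fl_top N n f closure_of cell (initial w')"
  have cellA: "cell (sublevel (level (initial v))) = cell (initial v)" if "v permutes {1..N}" for v
  proof (rule cell_cong)
    fix a assume a: "a \<in> {1..n}"
    show "sublevel (level (initial v)) a = initial v a"
      by (rule sublevel_level_initial[OF that a])
  qed
  have cardI: "card (initial v a) = f a" if "v permutes {1..N}" for v a
    unfolding initial_def using permutes_inj[OF that] by (simp add: card_image inj_on_subset[OF _ subset_UNIV])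
  have rk_le: "rk ?B a x \<le> rk ?A a x" if "x \<le> N" for a x
    using below unfolding below_def
    by (intro rk_level_le initial_mono initial_subset[OF w] initial_subset[OF w'] that) auto
  have full: "initial v a \<inter> {..N} = initial v a" if "v permutes {1..N}" "a \<in> {1..n}" for v a
    using initial_subset[OF that] by auto
  \<comment> \<open>At x = N the ranks are the cardinalities f a, common to both words.\<close>
  have rk_eq: "rk ?A a N = rk ?B a N" for a
  proof (rule antisym)
    show "rk ?A a N \<le> rk ?B a N"
      by (intro rk_level_le initial_mono initial_subset[OF w] initial_subset[OF w'])
        (simp_all add: full w w' cardI del: atLeastAtMost_iff One_nat_def)
    show "rk ?B a N \<le> rk ?A a N" using rk_le by simp
  qed
  have "cell (sublevel ?A) \<subseteq> ?cl"
  proof (rule bruhat_induct[of N ?B ?A "\<lambda>A. cell (sublevel A) \<subseteq> ?cl"])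
    fix A assume "\<And>y. y \<in> {1..N} \<Longrightarrow> A y = ?B y"
    then have "sublevel A = sublevel ?B" unfolding sublevel_def by (intro ext Collect_cong conj_cong) auto
    then have "cell (sublevel A) = cell (initial w')" using cellA[OF w'] by simp
    then show "cell (sublevel A) \<subseteq> ?cl"
      using closure_of_subset[of "cell (initial w')" "fl_top N n f"] cell_subset_Fl topspace_fl by simp
  next
    fix A k k' assume A: "\<And>a. rk A a N = rk ?B a N" "1 \<le> k" "k < k'" "k' \<le> N" "A k < A k'"
      "cell (sublevel (A \<circ> transpose k k')) \<subseteq> ?cl"
    have "card (sublevel A a) = f a" if a: "a \<in> {1..n}" for a
    proof -
      have "card (sublevel A a) = card (sublevel ?B a)"
        using A(1)[of a] unfolding rk_card sublevel_def .
      also have "sublevel ?B a = initial w' a"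
        by (rule sublevel_level_initial[OF w' a])
      finally show ?thesis using cardI[OF w'] by simp
    qed
    then show "cell (sublevel A) \<subseteq> ?cl" using cell_swap[OF _ A(2-5) closedin_closure_of A(6)] by blast
  qed (use rk_le rk_eq in auto)
  then show "cell (initial w) \<subseteq> ?cl" using cellA[OF w] by simp
qed

end

section \<open>The quiver Grassmannian\<close>

text \<open>Membership of k is the difference of two consecutive counts.\<close>

lemma eq_by_counts:
  fixes A B :: "nat set"
  assumes "A \<subseteq> {1..N}" "B \<subseteq> {1..N}" "\<And>k. k \<le> N \<Longrightarrow> card (A \<inter> {..k}) = card (B \<inter> {..k})"
  shows "A = B"
proof -
  have step: "card (C \<inter> {..k}) = card (C \<inter> {..k - 1}) + of_bool (k \<in> C)"
    if "k \<in> {1..N}" for C :: "nat set" and k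
  proof -
    have "C \<inter> {..k} = (if k \<in> C then insert k (C \<inter> {..k - 1}) else C \<inter> {..k - 1})"
      using that by (auto simp: le_Suc_eq) (metis One_nat_def Suc_pred le_SucE less_eq_Suc_le)+
    moreover have "k \<notin> C \<inter> {..k - 1}" using that by auto
    ultimately show ?thesis by simp
  qed
  have "k \<in> A \<longleftrightarrow> k \<in> B" if "k \<in> {1..N}" for k
  proof -
    have "k \<le> N" "k - 1 \<le> N" using that by auto
    then have "of_bool (k \<in> A) = (of_bool (k \<in> B) :: nat)"
      using step[OF that, of A] step[OF that, of B] assms(3)[of k] assms(3)[of "k - 1"] by linarith
    then show ?thesis by (simp only: of_bool_eq_iff)
  qed
  then show ?thesis using assms(1,2) by blast
qed

context flag_type
begin

lemma card_initial: "w permutes {1..N} \<Longrightarrow> card (initial w a) = f a"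
  unfolding initial_def by (simp add: card_image inj_on_subset[OF permutes_inj subset_UNIV])

lemma bruhat_le_iff_below:
  assumes "w permutes {1..N}" "w' permutes {1..N}"
  shows "bruhat_le n f w w' \<longleftrightarrow> below (initial w) (initial w')"
proof -
  have "list_all2 (\<le>) (sorted_list_of_set (w ` {1..f a})) (sorted_list_of_set (w' ` {1..f a})) \<longleftrightarrow>
      (\<forall>k. card (initial w' a \<inter> {..k}) \<le> card (initial w a \<inter> {..k}))" for a
    using list_all2_sorted_iff_card[of "initial w a" "initial w' a"] card_initial assms
    by (simp add: initial_def)
  then show ?thesis by (simp add: bruhat_le_def below_def)
qed

text \<open>This statistic is strictly monotone along the order, which gives a linear extension.\<close>
definition count_sum :: "(nat \<Rightarrow> nat) \<Rightarrow> nat" where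
  "count_sum w = (\<Sum>(a,k)\<in>{1..n} \<times> {..N}. card (initial w a \<inter> {..k}))"

text \<open>Each summand for w is at least the one for w', so the opposite inequality of the sums
  forces equality term by term, and the counts determine the sets.\<close>

lemma below_count_sum:
  assumes w: "w permutes {1..N}" "w' permutes {1..N}" and below: "below (initial w) (initial w')"
    and le: "count_sum w \<le> count_sum w'" and a: "a \<in> {1..n}"
  shows "initial w a = initial w' a"
proof (rule eq_by_counts)
  show "initial w a \<subseteq> {1..N}" "initial w' a \<subseteq> {1..N}" using initial_subset w a by auto
  have termwise: "(case x of (a,k) \<Rightarrow> card (initial w' a \<inter> {..k})) \<le> (case x of (a,k) \<Rightarrow> card (initial w a \<inter> {..k}))"
    if "x \<in> {1..n} \<times> {..N}" for x
    using below that by (auto simp: below_def)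
  have "count_sum w' \<le> count_sum w" unfolding count_sum_def by (rule sum_mono[OF termwise])
  then have eq: "count_sum w' = count_sum w" using le by simp
  show "card (initial w a \<inter> {..k}) = card (initial w' a \<inter> {..k})" if "k \<le> N" for k
    using sum_mono_inv[OF eq[unfolded count_sum_def] termwise, of "(a,k)"] that a by simp
qed

text \<open>The leads of the spaces form an increasing family with cardinalities f a; its word is
  realized by a permutation.\<close>

lemma exists_perm:
  assumes U: "U \<in> Fl N n f"
  obtains w where "w permutes {1..N}" "U \<in> cell (initial w)"
proof -
  have sub: "sublevel (level (\<lambda>a. leads (U a))) a = leads (U a)" if a: "a \<in> {1..n}" for a
  proof (rule sublevel_level[where I = "\<lambda>a. leads (U a)"])
    show "leads (U b) \<subseteq> leads (U c)" if "b \<in> {1..n}" "c \<in> {1..n}" "b \<le> c" for b c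
      by (rule leads_mono[OF Fl_mono[OF U that]])
    show "leads (U a) \<subseteq> {1..N}" by (rule leads_subset[OF Fl_D(2)[OF U a]])
  qed (rule a)
  have "card (sublevel (level (\<lambda>a. leads (U a))) a) = f a" if "a \<in> {1..n}" for a
    unfolding sub[OF that] by (rule Fl_D(3)[OF U that])
  then obtain w where "w permutes {1..N}"
    and "\<And>a. a \<in> {1..n} \<Longrightarrow> initial w a = sublevel (level (\<lambda>a. leads (U a))) a"
    using perm_of_word by blast
  then show thesis using that sub U by (simp add: cell_def)
qed

section \<open>Torus-fixed flags\<close>

lemma pfl_cell:
  assumes w: "w permutes {1..N}"
  shows "pfl n f w \<in> cell (initial w)"
proof -
  have "pfl n f w \<in> Fl N n f" unfolding pfl_frame[OF w] by (rule frame_Fl[OF perm_mat_GL[OF w]])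
  moreover have "leads (pfl n f w a) = initial w a" if "a \<in> {1..n}" for a
  proof -
    have "pfl n f w a = coord (initial w a)"
      using that by (simp add: pfl_def initial_def span_bvec)
    then show ?thesis using leads_coord by (simp add: initial_def)
  qed
  ultimately show ?thesis by (simp add: cell_def)
qed

text \<open>Diagonal matrices map coordinate subspaces into themselves, and as elements of
  \<open>Borel N\<close> they keep the leads, so the inclusion is an equality.\<close>

lemma torus_pfl:
  assumes w: "w permutes {1..N}" and t: "t \<in> Torus N"
  shows "act N t (pfl n f w) = pfl n f w"
proof (rule Fl_eq_by_leads)
  have "t \<in> Borel N" using t by (auto simp: Torus_def Borel_def)
  then have mem: "act N t (pfl n f w) \<in> cell (initial w)"
    unfolding Borbit_eq_cell[OF w, symmetric] Borbit_def by blast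
  then show "act N t (pfl n f w) \<in> Fl N n f" by (simp add: cell_def)
  show "pfl n f w \<in> Fl N n f" using pfl_cell[OF w] by (simp add: cell_def)
  fix a assume a: "a \<in> {1..n}"
  show "leads (act N t (pfl n f w) a) = leads (pfl n f w a)"
    using mem pfl_cell[OF w] a by (simp add: cell_def)
  have "pfl n f w a = coord (initial w a)"
    using a by (simp add: pfl_def initial_def span_bvec)
  moreover have "mvec N t y \<in> coord I" if "y \<in> coord I" for y I
  proof -
    have "t (i,j) * y j = 0" if "i \<notin> I" for i j
      using t \<open>y \<in> coord I\<close> that by (cases "i = j") (auto simp: Torus_def coord_def)
    then show ?thesis unfolding coord_def mvec_def by (auto intro!: sum.neutral)
  qed
  ultimately show "act N t (pfl n f w) a \<subseteq> pfl n f w a" unfolding act_def by auto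
qed

lemma torus_fixed_pfl:
  assumes w: "w permutes {1..N}" and U: "U \<in> cell (initial w)"
    and fixed: "\<And>t. t \<in> Torus N \<Longrightarrow> act N t U = U"
  shows "U = pfl n f w"
proof (rule sym, rule Fl_eq_by_leads)
  show UF: "U \<in> Fl N n f" and "pfl n f w \<in> Fl N n f"
    using U pfl_cell[OF w] by (simp_all add: cell_def)
  fix a assume a: "a \<in> {1..n}"
  show "leads (pfl n f w a) = leads (U a)"
    using U pfl_cell[OF w] a by (simp add: cell_def)
  have "bvec l \<in> U a" if l: "l \<in> initial w a" for l
  proof -
    have "l \<in> leads (U a)" using l U a by (auto simp: cell_def)
    then obtain y where y: "y \<in> U a" "y l \<noteq> 0" by (auto simp: leads_def lead_at_def)
    \<comment> \<open>With entry 2 at l and 1 elsewhere on the diagonal, t y - y is the l-th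
      component of y, a nonzero multiple of \<open>bvec l\<close>.\<close>
    define t :: matr where "t = (\<lambda>(i,j). if i = j \<and> j \<in> {1..N} then (if j = l then 2 else 1) else 0)"
    have "t \<in> Borel N"
      by (rule BorelI) (auto simp: t_def mat_supp_def lead_at_def colv_def)
    then have "t \<in> Torus N" by (auto simp: Torus_def Borel_def t_def)
    then have "mvec N t y \<in> U a" using fixed[of t] y(1) unfolding act_def by (metis imageI)
    then have "mvec N t y - y \<in> U a" using V.subspace_diff[OF Fl_D(1)[OF UF a]] y(1) by blast
    moreover have "mvec N t y - y = sc (y l) (bvec l)"
    proof
      fix i
      have "mvec N t y i = (\<Sum>j\<in>{1..N}. if j = i then (if i = l then 2 else 1) * y i else 0)"
        unfolding mvec_def by (rule sum.cong) (auto simp: t_def)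
      also have "\<dots> = (if i = l then 2 else 1) * y i"
        using Fl_D(2)[OF UF a] y(1) by (auto simp: coord_def)
      finally show "(mvec N t y - y) i = sc (y l) (bvec l) i"
        by (simp add: sc_apply bvec_def)
    qed
    ultimately have "sc (inverse (y l)) (sc (y l) (bvec l)) \<in> U a"
      using V.subspace_scale[OF Fl_D(1)[OF UF a]] by metis
    then show ?thesis using y(2) by simp
  qed
  then have "vspan (bvec ` initial w a) \<subseteq> U a"
    using Fl_D(1)[OF UF a] by (intro V.span_minimal) auto
  then show "pfl n f w a \<subseteq> U a"
    using a by (simp add: pfl_def initial_def)
qed

lemma compatible_iff: "w \<in> compatible N n f r q \<longleftrightarrow>
    w permutes {1..N} \<and> (\<forall>a\<in>{1..n}. {1..q a} \<subseteq> initial w a \<and> initial w a \<subseteq> {1..r a})"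
  by (simp add: compatible_def initial_def)

lemma perm_equiv_iff: "perm_equiv n f w w' \<longleftrightarrow> (\<forall>a\<in>{1..n}. initial w a = initial w' a)"
  by (simp add: perm_equiv_def initial_def)

section \<open>Restriction to Gr(Q, R) and the representatives in W\<close>

context
  fixes r q :: "nat \<Rightarrow> nat" and W :: "(nat \<Rightarrow> nat) set"
  assumes W: "is_W0 N n f r q W"
begin

lemma W_permutes: "w \<in> W \<Longrightarrow> w permutes {1..N}"
  using W by (auto simp: is_W0_def compatible_iff)

lemma W_inj:
  assumes "w \<in> W" "w' \<in> W" "\<And>a. a \<in> {1..n} \<Longrightarrow> initial w a = initial w' a"
  shows "w = w'"
proof -
  have "w \<in> compatible N n f r q" using W assms(1) by (auto simp: is_W0_def)
  then have "\<exists>!v. v \<in> W \<and> perm_equiv n f w v" using W unfolding is_W0_def by blast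
  moreover have "perm_equiv n f w w" "perm_equiv n f w w'"
    using assms(3) by (auto simp: perm_equiv_iff)
  ultimately show ?thesis using assms(1,2) by blast
qed

lemma finite_W: "finite W"
  by (rule finite_subset[OF _ finite_permutations[of "{1..N}"]]) (use W_permutes in auto)

lemma W_cell_subset: "w \<in> W \<Longrightarrow> cell (initial w) \<subseteq> GrQR N n f r q"
  using W by (auto simp: GrQR_iff cell_def is_W0_def compatible_iff)

lemma W_cover:
  assumes U: "U \<in> GrQR N n f r q"
  obtains w where "w \<in> W" "U \<in> cell (initial w)"
proof -
  have UF: "U \<in> Fl N n f" using U by (simp add: GrQR_iff)
  obtain v where v: "v permutes {1..N}" "U \<in> cell (initial v)" using exists_perm[OF UF] by blast
  then have "v \<in> compatible N n f r q" using U by (auto simp: compatible_iff GrQR_iff cell_def)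
  then obtain w where "w \<in> W" "perm_equiv n f v w" using W unfolding is_W0_def by blast
  then show thesis using that v(2) by (simp add: perm_equiv_iff cell_def)
qed

lemma W_orbit: "w \<in> W \<Longrightarrow> Borbit N n f w = cell (initial w)"
  by (rule Borbit_eq_cell[OF W_permutes])

lemma union_orbits: "(\<Union>w\<in>W. Borbit N n f w) = GrQR N n f r q"
proof
  show "(\<Union>w\<in>W. Borbit N n f w) \<subseteq> GrQR N n f r q" using W_cell_subset W_orbit by blast
  show "GrQR N n f r q \<subseteq> (\<Union>w\<in>W. Borbit N n f w)"
  proof
    fix U assume "U \<in> GrQR N n f r q"
    then obtain w where "w \<in> W" "U \<in> cell (initial w)" using W_cover by blast
    then show "U \<in> (\<Union>w\<in>W. Borbit N n f w)" using W_orbit by blast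
  qed
qed

lemma orbits_disjoint:
  assumes "w \<in> W" "w' \<in> W" "w \<noteq> w'"
  shows "Borbit N n f w \<inter> Borbit N n f w' = {}"
proof (rule ccontr)
  assume "Borbit N n f w \<inter> Borbit N n f w' \<noteq> {}"
  then obtain U where "U \<in> cell (initial w)" "U \<in> cell (initial w')" using W_orbit assms by blast
  then have "initial w a = initial w' a" if "a \<in> {1..n}" for a using that by (simp add: cell_def)
  then show False using W_inj assms by blast
qed

lemma torus_fixed_bij: "bij_betw (pfl n f) W (torus_fixed N (GrQR N n f r q))"
  unfolding bij_betw_def
proof
  show "inj_on (pfl n f) W"
  proof (rule inj_onI)
    fix w w' assume w: "w \<in> W" "w' \<in> W" "pfl n f w = pfl n f w'"
    have "initial w a = initial w' a" if "a \<in> {1..n}" for a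
      using pfl_cell[OF W_permutes[OF w(1)]] pfl_cell[OF W_permutes[OF w(2)]] w(3) that
      by (simp add: cell_def)
    then show "w = w'" using W_inj w by blast
  qed
  show "pfl n f ` W = torus_fixed N (GrQR N n f r q)"
  proof
    show "pfl n f ` W \<subseteq> torus_fixed N (GrQR N n f r q)"
      using pfl_cell[OF W_permutes] W_cell_subset torus_pfl[OF W_permutes]
      unfolding torus_fixed_def by blast
    show "torus_fixed N (GrQR N n f r q) \<subseteq> pfl n f ` W"
    proof
      fix U assume U: "U \<in> torus_fixed N (GrQR N n f r q)"
      then obtain w where w: "w \<in> W" "U \<in> cell (initial w)"
        using W_cover unfolding torus_fixed_def by blast
      then have "U = pfl n f w"
        using torus_fixed_pfl[OF W_permutes[OF w(1)]] U unfolding torus_fixed_def by blast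
      then show "U \<in> pfl n f ` W" using w(1) by blast
    qed
  qed
qed

text \<open>Closure in the subspace is the closure in the flag variety intersected with
  \<open>GrQR N n f r q\<close>, and this set contains both orbits.\<close>

lemma orbit_closure_iff:
  assumes "w \<in> W" "w' \<in> W"
  shows "Borbit N n f w \<subseteq> subtopology (fl_top N n f) (GrQR N n f r q) closure_of Borbit N n f w'
    \<longleftrightarrow> bruhat_le n f w w'"
proof -
  have "GrQR N n f r q \<inter> cell (initial w') = cell (initial w')" using W_cell_subset assms(2) by blast
  then have "subtopology (fl_top N n f) (GrQR N n f r q) closure_of cell (initial w')
      = GrQR N n f r q \<inter> fl_top N n f closure_of cell (initial w')"
    by (simp add: closure_of_subtopology)
  then show ?thesis
    using cell_closure_iff[OF W_permutes W_permutes, OF assms] W_cell_subset[OF assms(1)]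
      bruhat_le_iff_below[OF W_permutes W_permutes, OF assms]
    by (simp add: W_orbit assms)
qed

lemma W_antisym:
  assumes "w \<in> W" "w' \<in> W" "bruhat_le n f w w'" "bruhat_le n f w' w"
  shows "w = w'"
proof (rule W_inj[OF assms(1,2)])
  fix a assume a: "a \<in> {1..n}"
  have b: "below (initial w) (initial w')" "below (initial w') (initial w)"
    using assms bruhat_le_iff_below W_permutes by blast+
  then show "initial w a = initial w' a"
    using below_count_sum[of w w' a] below_count_sum[of w' w a] W_permutes assms(1,2) a
    by (metis nat_le_linear)
qed

lemma components_bij:
  "bij_betw (\<lambda>w. subtopology (fl_top N n f) (GrQR N n f r q) closure_of Borbit N n f w)
     (Smax n f W) (irreducible_components (subtopology (fl_top N n f) (GrQR N n f r q)))"
  unfolding Smax_def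
proof (rule components_of_irreducible_cover[OF finite_W])
  let ?X = "subtopology (fl_top N n f) (GrQR N n f r q)"
  show "irreducible_in ?X (Borbit N n f w)" if "w \<in> W" for w
    unfolding W_orbit[OF that]
    by (rule irreducible_subtopology[OF irreducible_cell[OF W_permutes[OF that]] W_cell_subset[OF that]])
  show "topspace ?X = (\<Union>w\<in>W. Borbit N n f w)"
    unfolding union_orbits topspace_subtopology topspace_fl by (auto simp: GrQR_def)
qed (use orbit_closure_iff W_antisym in auto)

text \<open>\<open>count_sum\<close> decreases when the tableau grows, so sorting puts larger
  elements first and every tail of the list is closed downwards. The union of a tail is therefore
  cut out by the finitely many closed sets \<open>schubert\<close> of its members.\<close>

lemma closed_filtration:
  "\<exists>ws. distinct ws \<and> set ws = W \<and> (\<forall>k\<le>length ws.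
    closedin (subtopology (fl_top N n f) (GrQR N n f r q)) (\<Union>i\<in>{k..<length ws}. Borbit N n f (ws ! i)))"
proof -
  obtain vs where vs: "distinct vs" "set vs = W" using finite_distinct_list[OF finite_W] by blast
  define ws where "ws = sort_key count_sum vs"
  have ws: "distinct ws" "set ws = W" "sorted (map count_sum ws)" using vs by (auto simp: ws_def)
  have "closedin (subtopology (fl_top N n f) (GrQR N n f r q)) (\<Union>i\<in>{k..<length ws}. Borbit N n f (ws ! i))" for k
  proof -
    let ?D = "\<Union>i\<in>{k..<length ws}. schubert (initial (ws ! i))"
    have inW: "ws ! i \<in> W" if "i < length ws" for i using ws(2) that nth_mem by blast
    have "(\<Union>i\<in>{k..<length ws}. Borbit N n f (ws ! i)) = ?D \<inter> GrQR N n f r q"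
    proof
      show "(\<Union>i\<in>{k..<length ws}. Borbit N n f (ws ! i)) \<subseteq> ?D \<inter> GrQR N n f r q"
      proof
        fix U assume "U \<in> (\<Union>i\<in>{k..<length ws}. Borbit N n f (ws ! i))"
        then obtain i where i: "i \<in> {k..<length ws}" "U \<in> cell (initial (ws ! i))"
          using W_orbit inW by auto
        then have "U \<in> schubert (initial (ws ! i))" by (simp add: schubert_def cell_def below_def)
        moreover have "U \<in> GrQR N n f r q" using W_cell_subset inW i by auto
        ultimately show "U \<in> ?D \<inter> GrQR N n f r q" using i(1) by blast
      qed
      show "?D \<inter> GrQR N n f r q \<subseteq> (\<Union>i\<in>{k..<length ws}. Borbit N n f (ws ! i))"
      proof
        fix U assume U: "U \<in> ?D \<inter> GrQR N n f r q"
        then obtain i where i: "i \<in> {k..<length ws}" "U \<in> schubert (initial (ws ! i))" by blast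
        obtain w where w: "w \<in> W" "U \<in> cell (initial w)" using W_cover U by blast
        obtain j where j: "j < length ws" "w = ws ! j" using w(1) ws(2) by (metis in_set_conv_nth)
        have iW: "ws ! i \<in> W" using inW i(1) by simp
        have below: "below (initial w) (initial (ws ! i))"
          using i(2) w(2) by (simp add: schubert_def cell_def below_def)
        have "\<exists>j\<in>{k..<length ws}. w = ws ! j"
        proof (cases "k \<le> j")
          case True
          then show ?thesis using j by auto
        next
          case False
          then have "map count_sum ws ! j \<le> map count_sum ws ! i"
            using i(1) by (intro sorted_nth_mono[OF ws(3)]) auto
          then have "count_sum w \<le> count_sum (ws ! i)" using i(1) j by simp
          then have "w = ws ! i"
            using below_count_sum[OF W_permutes[OF w(1)] W_permutes[OF iW] below]
            by (intro W_inj[OF w(1) iW]) auto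
          then show ?thesis using i(1) by blast
        qed
        then show "U \<in> (\<Union>i\<in>{k..<length ws}. Borbit N n f (ws ! i))"
          using w W_orbit by auto
      qed
    qed
    moreover have "closedin (fl_top N n f) ?D"
      by (rule closedin_Union) (auto intro: closedin_schubert)
    ultimately show ?thesis unfolding closedin_subtopology by blast
  qed
  then show ?thesis using ws by blast
qed

end

end

lemma rdim_mono: "a \<le> b \<Longrightarrow> rdim n m a \<le> rdim n m b"
  unfolding rdim_def by (intro sum_mono2) auto

theorem theorem3p10:
  fixes n :: nat and m :: "nat \<Rightarrow> nat \<Rightarrow> nat" and e :: "nat \<Rightarrow> nat"
    and W :: "(nat \<Rightarrow> nat) set"
  defines "r \<equiv> rdim n m" and "q \<equiv> qdim n m" and "N \<equiv> rdim n m n"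
    and "f \<equiv> (\<lambda>a. e a + qdim n m a)"
  assumes "n \<ge> 1"
    and "interval_mult n m" and "catenoid m"
    and "\<forall>a\<in>{1..<n}. f a \<le> f (Suc a)"
    and "is_W0 N n f r q W"
  shows "bij_betw (pfl n f) W (torus_fixed N (GrQR N n f r q))
    \<and> ((\<forall>w\<in>W. \<forall>w'\<in>W. w \<noteq> w' \<longrightarrow> Borbit N n f w \<inter> Borbit N n f w' = {})
       \<and> (\<Union>w\<in>W. Borbit N n f w) = GrQR N n f r q
       \<and> (\<forall>w\<in>W. affine_cell N n f (Borbit N n f w))
       \<and> (\<exists>ws. distinct ws \<and> set ws = W \<and>
            (\<forall>k\<le>length ws. closedin (subtopology (fl_top N n f) (GrQR N n f r q))
                               (\<Union>i\<in>{k..<length ws}. Borbit N n f (ws ! i)))))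
    \<and> bij_betw (\<lambda>w. subtopology (fl_top N n f) (GrQR N n f r q) closure_of Borbit N n f w)
         (Smax n f W)
         (irreducible_components (subtopology (fl_top N n f) (GrQR N n f r q)))"
proof (cases "\<forall>a\<in>{1..n}. f a \<le> N")
  case True
  then interpret flag_type N n f
    using assms(8) by unfold_locales auto
  note W = assms(9)
  have "affine_cell N n f (Borbit N n f w)" if "w \<in> W" for w
    unfolding W_orbit[OF W that] by (rule affine_cell_cell[OF W_permutes[OF W that]])
  then show ?thesis
    using torus_fixed_bij[OF W] orbits_disjoint[OF W] union_orbits[OF W] closed_filtration[OF W]
      components_bij[OF W] by blast
next
  case False
  \<comment> \<open>If some f a exceeds N, there is neither a flag nor a compatible permutation, so
    all three claims concern empty sets.\<close>
  then obtain a where a: "a \<in> {1..n}" "N < f a" by auto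
  have "U \<notin> GrQR N n f r q" for U
  proof
    assume "U \<in> GrQR N n f r q"
    then have U: "vsubspace (U a)" "U a \<subseteq> coord {1..N}" "vdim (U a) = f a"
      using a(1) by (auto simp: GrQR_def Fl_def std_span_eq)
    have "card (leads (U a)) \<le> card {1..N}" using leads_subset[OF U(2)] by (intro card_mono) auto
    then show False using dim_leads[OF U(1,2)] U(3) a(2) by simp
  qed
  then have empty: "GrQR N n f r q = {}" by blast
  have "w \<notin> compatible N n f r q" for w
  proof
    assume w: "w \<in> compatible N n f r q"
    \<comment> \<open>A permutation of {1..N} is injective on all natural numbers, so this holds
      although f a exceeds N.\<close>
    have "inj_on w {1..f a}"
      using w permutes_inj inj_on_subset unfolding compatible_def by blast
    then have "f a = card (w ` {1..f a})" by (simp add: card_image)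
    also have "\<dots> \<le> card {1..r a}"
      using w a(1) unfolding compatible_def by (intro card_mono) auto
    also have "\<dots> \<le> N" using a(1) rdim_mono[of a n n m] by (simp add: r_def N_def)
    finally show False using a(2) by simp
  qed
  then have "W = {}" using assms(9) by (auto simp: is_W0_def)
  have "irreducible_components (subtopology (fl_top N n f) {}) = {}"
    by (auto simp: irreducible_components_def irreducible_in_def)
  then show ?thesis
    unfolding empty \<open>W = {}\<close> by (auto simp: bij_betw_def torus_fixed_def Smax_def)
qed

end
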